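(* Let $p\ge 1$ be an integer and let $\Gamma\subset\mathbb{R}^3$ be a smooth surface. Consider a family of triangular meshes, with average edge length measured by $h\to 0$, whose vertices approximate $\Gamma$ with an error of $\mathcal{O}(h^{p+1})$, together with normal vectors at the vertices which approximate the normals of $\Gamma$ to $\mathcal{O}(h^{p})$. Assume that the rescaled Vandermonde systems arising in the degree-$p$ H-CMF reconstruction are well conditioned. Then the distance between each point on the H-CMF reconstructed surface (with degree-$p$ fittings) and its closest point on $\Gamma$ is $\mathcal{O}(h^{p+1})$.
   Context: Standing conventions. The meshes are relatively uniform (edge lengths comparable to $h$, stencils with a bounded number of points and diameter $\mathcal{O}(h)$) and correctly represent the topology of $\Gamma$; the local height functions of $\Gamma$ used below have derivatives up to order $p+1$ bounded uniformly; constants in $\mathcal{O}(\cdot)$ are independent of $h$ and of the point. Each vertex $\boldsymbol x_i$ carries (i) the given accurate normal $\boldsymbol n_i$, and (ii) an approximate unit normal $\boldsymbol m_i$ obtained by averaging the normals of the incident faces, which is first-order accurate. H-CMF (Hermite-style Continuous Moving Frames) reconstruction of degree $p$. Let $\boldsymbol p$ be a point of a mesh triangle $\boldsymbol x_1\boldsymbol x_2\boldsymbol x_3$ with barycentric coordinates $\xi_1,\xi_2,\xi_3$. (1) Local frame: $\boldsymbol m_0$ is the normalization of $\sum_{j=1}^3\xi_j\boldsymbol m_j$; $\boldsymbol s_0,\boldsymbol t_0$ are orthonormal vectors perpendicular to $\boldsymbol m_0$; $\boldsymbol Q_0=[\boldsymbol s_0,\boldsymbol t_0,\boldsymbol m_0]$.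 A point $\boldsymbol x$ has local coordinates $[u,v,w]^T=\boldsymbol Q_0^T(\boldsymbol x-\boldsymbol p)$, and near $\boldsymbol p$ the surface $\Gamma$ is the graph $w=f(u,v)$ of the local height function $f$. (2) Stencil: the union of the stencils of the vertices of the triangle (of the edge, if $\boldsymbol p$ lies on an edge), where the stencil of a vertex is a ring neighborhood of it: 1-ring for $p\le4$, 1.5-ring for $p=5$, 2-ring for $p=6$, enlarged adaptively if it contains too few points. (The 1-ring of a vertex consists of the vertices of its incident faces; the 1.5-ring adds the vertices of faces sharing an edge with those faces; the $(k+1)$-ring is the union of the 1-rings of the $k$-ring vertices.) (3) Fitting: for each stencil vertex $\boldsymbol x_i$, $1\le i\le m$, put $[u_i,v_i,f_i]^T=\boldsymbol Q_0^T(\boldsymbol x_i-\boldsymbol p)$, $[\alpha_i,\beta_i,\gamma_i]^T=\boldsymbol Q_0^T\boldsymbol n_i$, $\mu_i=u_i/h$, $\nu_i=v_i/h$. The rescaled Vandermonde system $\boldsymbol V\boldsymbol x\approx\boldsymbol g$ for the unknowns $x_{jk}$ ($j,k\ge0$, $j+k\le p$) consists of the $3m$ equations $$\sum_{j+k\le p}x_{jk}\mu_i^j\nu_i^k\approx f_i,\quad \sum_{j+k\le p}x_{jk}\,j\mu_i^{j-1}\nu_i^k\approx -h\frac{\alpha_i}{\gamma_i},\quad \sum_{j+k\le p}x_{jk}\,k\mu_i^{j}\nu_i^{k-1}\approx -h\frac{\beta_i}{\gamma_i}.$$ The three equations of point $i$ get the weight $\omega_i=\max(0,\boldsymbol m_i^T\boldsymbol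 m_0)\,\psi\big(\sqrt{u_i^2+v_i^2}/\rho\big)$ (folded points, $\gamma_i\le0$, get weight zero), where $\rho=c\,\|\boldsymbol u_{(k)}\|$ is a measure of the stencil radius, with $c>1$ a fixed constant and $\boldsymbol u_{(k)}$ the $k$th nearest stencil point to the origin in the $uv$-plane for a prescribed $k$; and $\psi$ is a Wendland function: $\psi_{3,1}(r)=(1-r)_+^4(4r+1)$ for $p\le2$, $\psi_{4,2}(r)=(1-r)_+^6(35r^2+18r+3)$ for $p=3,4$, $\psi_{5,3}(r)=(1-r)_+^8(32r^3+25r^2+8r+1)$ for $p=5,6$ (and some fixed Wendland function for larger $p$), with $(1-r)_+=\max\{0,1-r\}$. With $\boldsymbol\Omega$ the $3m\times3m$ diagonal matrix of these weights, $\boldsymbol x$ minimizes $\|\boldsymbol\Omega(\boldsymbol V\boldsymbol x-\boldsymbol g)\|_2$, and $c_{jk}=h^{-j-k}x_{jk}$. (4) Reconstructed point: $\boldsymbol p+c_{00}\boldsymbol m_0$. The H-CMF reconstructed surface is the set of these points as $\boldsymbol p$ ranges over the mesh. "Well conditioned" means that the matrices $\boldsymbol\Omega\boldsymbol V$ have full column rank and condition numbers $\|\boldsymbol\Omega\boldsymbol V\|\,\|(\boldsymbol\Omega\boldsymbol V)^+\|$ bounded by a constant independent of $h$ (so no terms of the polynomial are truncated). *)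

theory Defs
  imports "HOL-Analysis.Analysis" "HOL-Library.Multiset"
begin

section \<open>Smooth surfaces\<close>

definition iter_partial ::
  "'a list \<Rightarrow> ('a::euclidean_space \<Rightarrow> 'b::real_normed_vector) \<Rightarrow> 'a \<Rightarrow> 'b" where
  "iter_partial bs f = foldr (\<lambda>b g x. frechet_derivative g (at x) b) bs f"

definition Ck_on ::
  "nat \<Rightarrow> 'a::euclidean_space set \<Rightarrow> ('a \<Rightarrow> 'b::real_normed_vector) \<Rightarrow> bool" where
  "Ck_on n U f \<longleftrightarrow>
     (\<forall>bs. set bs \<subseteq> Basis \<longrightarrow>
        (length bs < n \<longrightarrow> (\<forall>x\<in>U. iter_partial bs f differentiable (at x))) \<and>
        (length bs \<le> n \<longrightarrow> continuous_on U (iter_partial bs f)))"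

definition smooth_on ::
  "'a::euclidean_space set \<Rightarrow> ('a \<Rightarrow> 'b::real_normed_vector) \<Rightarrow> bool" where
  "smooth_on U f \<longleftrightarrow> (\<forall>n. Ck_on n U f)"

definition derivs_bounded ::
  "nat \<Rightarrow> real \<Rightarrow> 'a::euclidean_space set \<Rightarrow> ('a \<Rightarrow> 'b::real_normed_vector) \<Rightarrow> bool" where
  "derivs_bounded n M U f \<longleftrightarrow>
     (\<forall>bs. set bs \<subseteq> Basis \<and> length bs \<le> n \<longrightarrow> (\<forall>x\<in>U. norm (iter_partial bs f x) \<le> M))"

text \<open>Regular embedded surfaces without boundary.\<close>

definition smooth_surface :: "(real^3) set \<Rightarrow> bool" where
  "smooth_surface \<Gamma> \<longleftrightarrow>
     (\<forall>x\<in>\<Gamma>. \<exists>W (U::(real \<times> real) set) \<phi> \<phi>'.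
        open W \<and> x \<in> W \<and> open U \<and> homeomorphism U (\<Gamma> \<inter> W) \<phi> \<phi>' \<and> smooth_on U \<phi> \<and>
        (\<forall>z\<in>U. inj (frechet_derivative \<phi> (at z))))"

definition tangent_vector :: "(real^3) set \<Rightarrow> real^3 \<Rightarrow> real^3 \<Rightarrow> bool" where
  "tangent_vector \<Gamma> x d \<longleftrightarrow>
     (\<exists>\<gamma>. \<gamma> 0 = x \<and> (\<forall>\<^sub>F t in at (0::real). \<gamma> t \<in> \<Gamma>) \<and> (\<gamma> has_vector_derivative d) (at 0))"

definition unit_normal_field :: "(real^3) set \<Rightarrow> (real^3 \<Rightarrow> real^3) \<Rightarrow> bool" where
  "unit_normal_field \<Gamma> \<nu> \<longleftrightarrow> continuous_on \<Gamma> \<nu> \<and>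
     (\<forall>x\<in>\<Gamma>. norm (\<nu> x) = 1 \<and> (\<forall>d. tangent_vector \<Gamma> x d \<longrightarrow> \<nu> x \<bullet> d = 0))"


section \<open>Triangular meshes\<close>

text \<open>A mesh is a set of oriented triangles. Vertices are identified with their positions.\<close>

type_synonym tri = "(real^3) \<times> (real^3) \<times> (real^3)"

definition tri_verts :: "tri \<Rightarrow> (real^3) set" where
  "tri_verts = (\<lambda>(a, b, c). {a, b, c})"

definition dir_edges :: "tri \<Rightarrow> ((real^3) \<times> (real^3)) set" where
  "dir_edges = (\<lambda>(a, b, c). {(a, b), (b, c), (c, a)})"

definition face_normal :: "tri \<Rightarrow> real^3" where
  "face_normal = (\<lambda>(a, b, c). sgn (cross3 (b - a) (c - a)))"

text \<open>
  The last two conjuncts express coherent orientation: no face occurs twice, and two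
  faces never traverse a common edge in the same direction.
\<close>

definition triangular_mesh :: "tri set \<Rightarrow> bool" where
  "triangular_mesh T \<longleftrightarrow> finite T \<and>
     (\<forall>f\<in>T. card (tri_verts f) = 3 \<and> \<not> affine_dependent (tri_verts f)) \<and>
     triangulation ((\<lambda>f. convex hull (tri_verts f)) ` T) \<and>
     inj_on tri_verts T \<and>
     (\<forall>f\<in>T. \<forall>g\<in>T. dir_edges f \<inter> dir_edges g \<noteq> {} \<longrightarrow> f = g)"

definition mesh_verts :: "tri set \<Rightarrow> (real^3) set" where
  "mesh_verts T = (\<Union>f\<in>T. tri_verts f)"

definition mesh_edges :: "tri set \<Rightarrow> (real^3) set set" where
  "mesh_edges T = {e. card e = 2 \<and> (\<exists>f\<in>T. e \<subseteq> tri_verts f)}"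

definition mesh_space :: "tri set \<Rightarrow> (real^3) set" where
  "mesh_space T = (\<Union>f\<in>T. convex hull (tri_verts f))"

definition mesh_size :: "tri set \<Rightarrow> real" where
  "mesh_size T = (\<Sum>e\<in>mesh_edges T. diameter e) / real (card (mesh_edges T))"

definition one_ring :: "tri set \<Rightarrow> real^3 \<Rightarrow> (real^3) set" where
  "one_ring T v = (\<Union>f\<in>{f\<in>T. v \<in> tri_verts f}. tri_verts f)"

definition one_half_ring :: "tri set \<Rightarrow> real^3 \<Rightarrow> (real^3) set" where
  "one_half_ring T v = one_ring T v \<union>
     \<Union> {tri_verts g | f g. f \<in> T \<and> g \<in> T \<and> v \<in> tri_verts f \<and>
           card (tri_verts f \<inter> tri_verts g) = 2}"

text \<open>The index counts half rings beyond the first: index \<open>n\<close> is the \<open>(1 + n/2)\<close>-ring.\<close>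

fun ring_nbhd :: "tri set \<Rightarrow> nat \<Rightarrow> real^3 \<Rightarrow> (real^3) set" where
  "ring_nbhd T 0 v = one_ring T v"
| "ring_nbhd T (Suc 0) v = one_half_ring T v"
| "ring_nbhd T (Suc (Suc n)) v = (\<Union>u\<in>ring_nbhd T n v. one_ring T u)"

text \<open>
  Piecewise linear interpolation of vertex data by barycentric coordinates. At a point shared
  by several faces of a mesh, all faces give the same value.
\<close>

definition bary_interp :: "tri set \<Rightarrow> (real^3 \<Rightarrow> real^3) \<Rightarrow> real^3 \<Rightarrow> real^3" where
  "bary_interp T \<phi> x = (SOME y. \<exists>a b c \<xi>1 \<xi>2 \<xi>3.
     (a, b, c) \<in> T \<and> 0 \<le> \<xi>1 \<and> 0 \<le> \<xi>2 \<and> 0 \<le> \<xi>3 \<and> \<xi>1 + \<xi>2 + \<xi>3 = 1 \<and>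
     x = \<xi>1 *\<^sub>R a + \<xi>2 *\<^sub>R b + \<xi>3 *\<^sub>R c \<and>
     y = \<xi>1 *\<^sub>R \<phi> a + \<xi>2 *\<^sub>R \<phi> b + \<xi>3 *\<^sub>R \<phi> c)"


section \<open>Rectangular matrices over finite index sets\<close>

text \<open>
  A matrix with row set \<open>R\<close> and column set \<open>C\<close> is a function of two arguments, of which only
  the values on \<open>R\<close> and \<open>C\<close> matter; likewise for vectors, whose Euclidean norm is
  \<^const>\<open>L2_set\<close>.
\<close>

definition mat_vec :: "'c set \<Rightarrow> ('r \<Rightarrow> 'c \<Rightarrow> real) \<Rightarrow> ('c \<Rightarrow> real) \<Rightarrow> 'r \<Rightarrow> real" where
  "mat_vec C A x = (\<lambda>r. \<Sum>c\<in>C. A r c * x c)"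

definition mat_mul ::
  "'b set \<Rightarrow> ('a \<Rightarrow> 'b \<Rightarrow> real) \<Rightarrow> ('b \<Rightarrow> 'c \<Rightarrow> real) \<Rightarrow> 'a \<Rightarrow> 'c \<Rightarrow> real" where
  "mat_mul S A B = (\<lambda>a c. \<Sum>b\<in>S. A a b * B b c)"

definition mat_norm :: "'r set \<Rightarrow> 'c set \<Rightarrow> ('r \<Rightarrow> 'c \<Rightarrow> real) \<Rightarrow> real" where
  "mat_norm R C A = (SUP x\<in>{x. L2_set x C \<le> 1}. L2_set (mat_vec C A x) R)"

definition full_column_rank :: "'r set \<Rightarrow> 'c set \<Rightarrow> ('r \<Rightarrow> 'c \<Rightarrow> real) \<Rightarrow> bool" where
  "full_column_rank R C A \<longleftrightarrow>
     (\<forall>x. (\<forall>r\<in>R. (\<Sum>c\<in>C. x c * A r c) = 0) \<longrightarrow> (\<forall>c\<in>C. x c = 0))"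

text \<open>The four Penrose conditions, which determine \<open>B\<close> uniquely on \<open>C\<close> and \<open>R\<close>.\<close>

definition moore_penrose ::
  "'r set \<Rightarrow> 'c set \<Rightarrow> ('r \<Rightarrow> 'c \<Rightarrow> real) \<Rightarrow> ('c \<Rightarrow> 'r \<Rightarrow> real) \<Rightarrow> bool" where
  "moore_penrose R C A B \<longleftrightarrow>
     (\<forall>r\<in>R. \<forall>c\<in>C. mat_mul R (mat_mul C A B) A r c = A r c) \<and>
     (\<forall>c\<in>C. \<forall>r\<in>R. mat_mul C (mat_mul R B A) B c r = B c r) \<and>
     (\<forall>r\<in>R. \<forall>r'\<in>R. mat_mul C A B r r' = mat_mul C A B r' r) \<and>
     (\<forall>c\<in>C. \<forall>c'\<in>C. mat_mul R B A c c' = mat_mul R B A c' c)"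

definition cond_number_le :: "'r set \<Rightarrow> 'c set \<Rightarrow> ('r \<Rightarrow> 'c \<Rightarrow> real) \<Rightarrow> real \<Rightarrow> bool" where
  "cond_number_le R C A K \<longleftrightarrow>
     (\<exists>B. moore_penrose R C A B \<and> mat_norm R C A * mat_norm C R B \<le> K)"


section \<open>Wendland functions\<close>

text \<open>
  Wendland's function \<open>\<psi>\<^sub>l\<^sub>,\<^sub>k\<close> arises from \<open>(1 - r)\<^sub>+\<^sup>l\<close> by \<open>k\<close> applications of the
  operator taking \<open>g\<close> to the integral of \<open>t g(t)\<close> from \<open>r\<close> to infinity; it is customarily
  normalized by a positive factor. All these functions vanish beyond \<open>1\<close>.
\<close>

definition wendland_int :: "(real \<Rightarrow> real) \<Rightarrow> real \<Rightarrow> real" where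
  "wendland_int g r = integral {r..1} (\<lambda>t. t * g t)"

definition wendland :: "(real \<Rightarrow> real) \<Rightarrow> bool" where
  "wendland \<psi> \<longleftrightarrow> (\<exists>l k a. 1 \<le> l \<and> 0 < a \<and>
     (\<forall>r\<ge>0. \<psi> r = a * (wendland_int ^^ k) (\<lambda>t. max 0 (1 - t) ^ l) r))"


section \<open>The H-CMF reconstruction\<close>

text \<open>
  Constants fixed for the whole family of meshes: the factor and the index in the stencil radius,
  the number of points below which a stencil is enlarged, and the choices of ring
  and Wendland function for degrees above 6.
\<close>

record hcmf_consts =
  rad_factor :: real
  rad_index :: nat
  min_points :: nat
  high_ring :: nat
  high_psi :: "real \<Rightarrow> real"

definition hcmf_consts_ok :: "hcmf_consts \<Rightarrow> bool" where
  "hcmf_consts_ok P \<longleftrightarrow> 1 < rad_factor P \<and> 1 \<le> rad_index P \<and> rad_index P \<le> min_points P \<and>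
     wendland (high_psi P)"

definition default_ring :: "hcmf_consts \<Rightarrow> nat \<Rightarrow> nat" where
  "default_ring P p =
     (if p \<le> 4 then 0 else if p = 5 then 1 else if p = 6 then 2 else high_ring P)"

definition hcmf_psi :: "hcmf_consts \<Rightarrow> nat \<Rightarrow> real \<Rightarrow> real" where
  "hcmf_psi P p r =
     (if p \<le> 2 then max 0 (1 - r) ^ 4 * (4 * r + 1)
      else if p \<le> 4 then max 0 (1 - r) ^ 6 * (35 * r\<^sup>2 + 18 * r + 3)
      else if p \<le> 6 then max 0 (1 - r) ^ 8 * (32 * r ^ 3 + 25 * r\<^sup>2 + 8 * r + 1)
      else high_psi P r)"

text \<open>
  A mesh with the data of the reconstruction: the given normals \<open>nrm\<close> and
  the averaged normals \<open>anrm\<close> at the vertices, the ring index \<open>ridx\<close> of the stencil of each vertex,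
  and, for each point of the mesh, the tangential frame vectors \<open>svec\<close>, \<open>tvec\<close> and the vertex set
  \<open>cell\<close> of the triangle or edge on whose vertices its stencil is based.
\<close>

record hcmf =
  faces :: "tri set"
  nrm :: "real^3 \<Rightarrow> real^3"
  anrm :: "real^3 \<Rightarrow> real^3"
  ridx :: "real^3 \<Rightarrow> nat"
  svec :: "real^3 \<Rightarrow> real^3"
  tvec :: "real^3 \<Rightarrow> real^3"
  cell :: "real^3 \<Rightarrow> (real^3) set"

abbreviation hsize :: "hcmf \<Rightarrow> real" where
  "hsize H \<equiv> mesh_size (faces H)"

definition mvec :: "hcmf \<Rightarrow> real^3 \<Rightarrow> real^3" where
  "mvec H x = sgn (bary_interp (faces H) (anrm H) x)"

definition vertex_stencil :: "hcmf \<Rightarrow> real^3 \<Rightarrow> (real^3) set" where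
  "vertex_stencil H v = ring_nbhd (faces H) (ridx H v) v"

definition stencil :: "hcmf \<Rightarrow> real^3 \<Rightarrow> (real^3) set" where
  "stencil H x = (\<Union>v\<in>cell H x. vertex_stencil H v)"

text \<open>
  The condition on \<open>cell\<close> makes it the whole triangle in the interior of a face
  and the whole edge in the relative interior of an edge; at a vertex
  it may be any incident edge, or the vertex alone.
\<close>

definition hcmf_ok :: "hcmf_consts \<Rightarrow> nat \<Rightarrow> hcmf \<Rightarrow> bool" where
  "hcmf_ok P p H \<longleftrightarrow>
     triangular_mesh (faces H) \<and>
     (\<forall>v\<in>mesh_verts (faces H).
        (let I = {f\<in>faces H. v \<in> tri_verts f} in
           \<exists>w. (\<forall>f\<in>I. 0 < w f) \<and> sum w I = 1 \<and> 
             (\<Sum>f\<in>I. w f *\<^sub>R face_normal f) \<noteq> 0 \<and>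
             anrm H v = sgn (\<Sum>f\<in>I. w f *\<^sub>R face_normal f)) \<and>
        default_ring P p \<le> ridx H v \<and>
        (default_ring P p < ridx H v \<longrightarrow>
           card (ring_nbhd (faces H) (default_ring P p) v) < min_points P) \<and>
        min_points P \<le> card (vertex_stencil H v)) \<and>
     (\<forall>x\<in>mesh_space (faces H).
        norm (svec H x) = 1 \<and> norm (tvec H x) = 1 \<and> norm (mvec H x) = 1 \<and>
        svec H x \<bullet> tvec H x = 0 \<and> svec H x \<bullet> mvec H x = 0 \<and> tvec H x \<bullet> mvec H x = 0 \<and>
        (\<exists>f\<in>faces H. cell H x \<subseteq> tri_verts f) \<and> x \<in> convex hull (cell H x) \<and>
        ((\<exists>e\<in>mesh_edges (faces H). x \<in> convex hull e) \<longrightarrow> card (cell H x) \<le> 2))"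

definition uv :: "hcmf \<Rightarrow> real^3 \<Rightarrow> real^3 \<Rightarrow> real \<times> real" where
  "uv H x y = (svec H x \<bullet> (y - x), tvec H x \<bullet> (y - x))"

definition stencil_radius :: "hcmf_consts \<Rightarrow> hcmf \<Rightarrow> real^3 \<Rightarrow> real" where
  "stencil_radius P H x = rad_factor P *
     (sorted_list_of_multiset (image_mset (\<lambda>y. norm (uv H x y)) (mset_set (stencil H x)))
        ! (rad_index P - 1))"

definition hcmf_weight :: "hcmf_consts \<Rightarrow> nat \<Rightarrow> hcmf \<Rightarrow> real^3 \<Rightarrow> real^3 \<Rightarrow> real" where
  "hcmf_weight P p H x y =
     (if mvec H x \<bullet> nrm H y \<le> 0 then 0
      else max 0 (anrm H y \<bullet> mvec H x) *
           hcmf_psi P p (norm (uv H x y) / stencil_radius P H x))"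

datatype eqn = Value | DerivU | DerivV

definition fit_rows :: "hcmf \<Rightarrow> real^3 \<Rightarrow> ((real^3) \<times> eqn) set" where
  "fit_rows H x = stencil H x \<times> {Value, DerivU, DerivV}"

definition fit_cols :: "nat \<Rightarrow> (nat \<times> nat) set" where
  "fit_cols p = {(j, k). j + k \<le> p}"

fun vandermonde :: "hcmf \<Rightarrow> real^3 \<Rightarrow> (real^3) \<times> eqn \<Rightarrow> nat \<times> nat \<Rightarrow> real" where
  "vandermonde H x (y, e) (j, k) =
     (let \<mu> = fst (uv H x y) / hsize H; \<nu> = snd (uv H x y) / hsize H in
      case e of
        Value \<Rightarrow> \<mu> ^ j * \<nu> ^ k
      | DerivU \<Rightarrow> real j * \<mu> ^ (j - 1) * \<nu> ^ k
      | DerivV \<Rightarrow> real k * \<mu> ^ j * \<nu> ^ (k - 1))"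

fun fit_rhs :: "hcmf \<Rightarrow> real^3 \<Rightarrow> (real^3) \<times> eqn \<Rightarrow> real" where
  "fit_rhs H x (y, e) =
     (let \<alpha> = svec H x \<bullet> nrm H y; \<beta> = tvec H x \<bullet> nrm H y; \<gamma> = mvec H x \<bullet> nrm H y in
      case e of
        Value \<Rightarrow> mvec H x \<bullet> (y - x)
      | DerivU \<Rightarrow> - hsize H * (\<alpha> / \<gamma>)
      | DerivV \<Rightarrow> - hsize H * (\<beta> / \<gamma>))"

definition weighted_vandermonde ::
  "hcmf_consts \<Rightarrow> nat \<Rightarrow> hcmf \<Rightarrow> real^3 \<Rightarrow> (real^3) \<times> eqn \<Rightarrow> nat \<times> nat \<Rightarrow> real" where
  "weighted_vandermonde P p H x =
     (\<lambda>r c. hcmf_weight P p H x (fst r) * vandermonde H x r c)"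

definition fit_solution ::
  "hcmf_consts \<Rightarrow> nat \<Rightarrow> hcmf \<Rightarrow> real^3 \<Rightarrow> (nat \<times> nat \<Rightarrow> real) \<Rightarrow> bool" where
  "fit_solution P p H x X \<longleftrightarrow>
     is_arg_min
       (\<lambda>X. L2_set (\<lambda>r. hcmf_weight P p H x (fst r) *
                          (mat_vec (fit_cols p) (vandermonde H x) X r - fit_rhs H x r))
              (fit_rows H x))
       (\<lambda>_. True) X"

definition fit_coeff :: "hcmf \<Rightarrow> (nat \<times> nat \<Rightarrow> real) \<Rightarrow> nat \<Rightarrow> nat \<Rightarrow> real" where
  "fit_coeff H X j k = X (j, k) / hsize H ^ (j + k)"

definition hcmf_surface :: "hcmf_consts \<Rightarrow> nat \<Rightarrow> hcmf \<Rightarrow> (real^3) set" where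
  "hcmf_surface P p H =
     {x + fit_coeff H X 0 0 *\<^sub>R mvec H x | x X. x \<in> mesh_space (faces H) \<and> fit_solution P p H x X}"


section \<open>Assumptions on families of meshes\<close>

text \<open>
  The surface is the graph of \<open>f\<close> over the tangential disk of radius \<open>r\<close>
  in the local frame at \<open>x\<close>, with no other sheet within distance \<open>r\<close> of \<open>x\<close>.
\<close>

definition local_height ::
  "(real^3) set \<Rightarrow> hcmf \<Rightarrow> real^3 \<Rightarrow> real \<Rightarrow> (real \<times> real \<Rightarrow> real) \<Rightarrow> bool" where
  "local_height \<Gamma> H x r f \<longleftrightarrow>
     (\<forall>z\<in>ball 0 r. x + fst z *\<^sub>R svec H x + snd z *\<^sub>R tvec H x + f z *\<^sub>R mvec H x \<in> \<Gamma>) \<and>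
     (\<forall>y\<in>\<Gamma> \<inter> ball x r. mvec H x \<bullet> (y - x) = f (uv H x y))"

definition heights_bounded ::
  "nat \<Rightarrow> (real^3) set \<Rightarrow> 'i filter \<Rightarrow> ('i \<Rightarrow> hcmf) \<Rightarrow> bool" where
  "heights_bounded n \<Gamma> F H \<longleftrightarrow>
     (\<exists>r>0. \<exists>M. \<forall>\<^sub>F i in F. \<forall>x\<in>mesh_space (faces (H i)). \<exists>f.
        local_height \<Gamma> (H i) x r f \<and> Ck_on n (ball 0 r) f \<and> derivs_bounded n M (ball 0 r) f)"

definition relatively_uniform :: "'i filter \<Rightarrow> ('i \<Rightarrow> hcmf) \<Rightarrow> bool" where
  "relatively_uniform F H \<longleftrightarrow>
     (\<exists>a>0. \<exists>b. \<forall>\<^sub>F i in F. \<forall>e\<in>mesh_edges (faces (H i)).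
        a * hsize (H i) \<le> diameter e \<and> diameter e \<le> b * hsize (H i)) \<and>
     (\<exists>m C. \<forall>\<^sub>F i in F. \<forall>x\<in>mesh_space (faces (H i)).
        card (stencil (H i) x) \<le> m \<and> diameter (stencil (H i) x) \<le> C * hsize (H i))"

definition vertices_accurate ::
  "nat \<Rightarrow> (real^3) set \<Rightarrow> 'i filter \<Rightarrow> ('i \<Rightarrow> hcmf) \<Rightarrow> bool" where
  "vertices_accurate n \<Gamma> F H \<longleftrightarrow>
     (\<exists>C. \<forall>\<^sub>F i in F. \<forall>v\<in>mesh_verts (faces (H i)).
        dist v (closest_point \<Gamma> v) \<le> C * hsize (H i) ^ n)"

definition normals_accurate ::
  "nat \<Rightarrow> (real^3) set \<Rightarrow> (real^3 \<Rightarrow> real^3) \<Rightarrow> 'i filter \<Rightarrow> ('i \<Rightarrow> hcmf) \<Rightarrow>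
   (hcmf \<Rightarrow> real^3 \<Rightarrow> real^3) \<Rightarrow> bool" where
  "normals_accurate n \<Gamma> \<nu> F H nv \<longleftrightarrow>
     (\<exists>C. \<forall>\<^sub>F i in F. \<forall>v\<in>mesh_verts (faces (H i)).
        norm (nv (H i) v - \<nu> (closest_point \<Gamma> v)) \<le> C * hsize (H i) ^ n)"

definition well_conditioned ::
  "hcmf_consts \<Rightarrow> nat \<Rightarrow> 'i filter \<Rightarrow> ('i \<Rightarrow> hcmf) \<Rightarrow> bool" where
  "well_conditioned P p F H \<longleftrightarrow>
     (\<exists>K. \<forall>\<^sub>F i in F. \<forall>x\<in>mesh_space (faces (H i)).
        full_column_rank (fit_rows (H i) x) (fit_cols p) (weighted_vandermonde P p (H i) x) \<and>
        cond_number_le (fit_rows (H i) x) (fit_cols p) (weighted_vandermonde P p (H i) x) K)"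

end

theory Submission
  imports Defs
begin

text \<open>
  Fix a mesh point \<open>x\<close>. The rescaled Taylor coefficients of the height function \<open>f\<close> satisfy every
  unweighted equation of the fitting system up to \<open>O(h^(p+1))\<close>: the value equations because the
  vertices are accurate to that order, the derivative equations because their right-hand sides carry
  a factor \<open>h\<close> and the unit normal is orthogonal to the tangent vectors \<open>s + f\<^sub>u m\<close> and \<open>t + f\<^sub>v m\<close>.
  The least squares solution has no larger residual, so it differs from the Taylor coefficients by at
  most \<open>2 \<parallel>(\<Omega>V)\<^sup>+\<parallel>\<close> times the weighted residual. The column of the constant term has the weights
  themselves as entries in the value rows, so \<open>\<parallel>\<Omega>V\<parallel>\<close> bounds every weight, and the condition number
  absorbs both factors. Finally \<open>x + f(0) m\<close> lies on \<open>\<Gamma>\<close>.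
\<close>

section \<open>Perturbation of least squares problems\<close>

lemma bdd_above_mat_norm:
  assumes "finite R" "finite C"
  shows "bdd_above ((\<lambda>x. L2_set (mat_vec C A x) R) ` {x. L2_set x C \<le> 1})"
proof (rule bdd_aboveI2)
  fix x :: "'b \<Rightarrow> real"
  assume "x \<in> {x. L2_set x C \<le> 1}"
  then have x1: "\<bar>x c\<bar> \<le> 1" if "c \<in> C" for c
    using order_trans[OF member_le_L2_set[OF assms(2) that, of "\<lambda>c. \<bar>x c\<bar>"], of 1]
    by (simp add: L2_set_def)
  have "L2_set (mat_vec C A x) R \<le> (\<Sum>r\<in>R. \<bar>mat_vec C A x r\<bar>)"
    by (rule L2_set_le_sum_abs)
  also have "\<dots> \<le> (\<Sum>r\<in>R. \<Sum>c\<in>C. \<bar>A r c\<bar>)"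
    unfolding mat_vec_def
    by (intro sum_mono order_trans[OF sum_abs])
      (simp add: abs_mult x1 mult_left_le)
  finally show "L2_set (mat_vec C A x) R \<le> (\<Sum>r\<in>R. \<Sum>c\<in>C. \<bar>A r c\<bar>)" .
qed

lemma mat_norm_nonneg:
  assumes "finite R" "finite C"
  shows "0 \<le> mat_norm R C A"
  unfolding mat_norm_def
  by (rule cSUP_upper2[OF bdd_above_mat_norm[OF assms], of "\<lambda>_. 0"])
    (simp_all add: L2_set_def sum_nonneg)

lemma mat_norm_bound:
  assumes "finite R" "finite C"
  shows "L2_set (mat_vec C A x) R \<le> mat_norm R C A * L2_set x C"
proof (cases "L2_set x C = 0")
  case True
  then have "x c = 0" if "c \<in> C" for c
    using that assms(2) by (simp add: L2_set_eq_0_iff)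
  then have "L2_set (mat_vec C A x) R = 0"
    by (intro L2_set_0') (simp add: mat_vec_def)
  then show ?thesis by (simp add: True)
next
  case False
  define l where "l = L2_set x C"
  have l: "0 < l" using False L2_set_nonneg[of x C] unfolding l_def by linarith
  have mv: "mat_vec C A (\<lambda>c. inverse l * x c) = (\<lambda>r. inverse l * mat_vec C A x r)"
    by (simp add: mat_vec_def sum_distrib_left algebra_simps)
  have "L2_set (\<lambda>c. inverse l * x c) C = inverse l * l"
    unfolding l_def using l by (subst L2_set_right_distrib) (auto simp: l_def)
  then have "L2_set (mat_vec C A (\<lambda>c. inverse l * x c)) R \<le> mat_norm R C A"
    unfolding mat_norm_def using l
    by (intro cSUP_upper bdd_above_mat_norm assms) auto
  then have "inverse l * L2_set (mat_vec C A x) R \<le> mat_norm R C A"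
    unfolding mv using l by (subst L2_set_right_distrib) auto
  then show ?thesis using l unfolding l_def[symmetric] by (simp add: field_simps)
qed

lemma entry_le_mat_norm:
  assumes "finite R" "finite C" "r \<in> R" "c \<in> C"
  shows "\<bar>A r c\<bar> \<le> mat_norm R C A"
proof -
  let ?e = "\<lambda>c'. if c' = c then 1 else 0 :: real"
  have mv: "mat_vec C A ?e r = A r c" for r
    using assms(2,4) by (simp add: mat_vec_def if_distrib[of "\<lambda>x. _ * x"] sum.delta cong: if_cong)
  have "L2_set ?e C = 1"
    using assms(2,4)
    by (simp add: L2_set_def if_distrib[of "\<lambda>x. x ^ 2"] sum.delta cong: if_cong)
  then have "L2_set (mat_vec C A ?e) R \<le> mat_norm R C A"
    using mat_norm_bound[OF assms(1,2), of A ?e] by simp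
  moreover have "\<bar>A r c\<bar> \<le> L2_set (mat_vec C A ?e) R"
    using member_le_L2_set[OF assms(1,3), of "\<lambda>r. \<bar>mat_vec C A ?e r\<bar>"]
    by (simp add: mv L2_set_def)
  ultimately show ?thesis by linarith
qed

lemma moore_penrose_left_inverse:
  assumes fin: "finite R" "finite C" and full: "full_column_rank R C A"
    and mp: "moore_penrose R C A B" and c: "c \<in> C"
  shows "mat_vec R B (mat_vec C A x) c = x c"
proof -
  define y where "y = (\<lambda>c. mat_vec R B (mat_vec C A x) c - x c)"
  have "(\<Sum>c\<in>C. y c * A r c) = 0" if r: "r \<in> R" for r
  proof -
    have "mat_vec C A x r = (\<Sum>c\<in>C. mat_mul R (mat_mul C A B) A r c * x c)"
      using mp r by (simp add: moore_penrose_def mat_vec_def)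
    also have "\<dots> = (\<Sum>c\<in>C. \<Sum>q\<in>R. \<Sum>d\<in>C. A r d * B d q * A q c * x c)"
      by (simp add: mat_mul_def sum_distrib_right)
    also have "\<dots> = (\<Sum>q\<in>R. \<Sum>c\<in>C. \<Sum>d\<in>C. A r d * B d q * A q c * x c)"
      by (rule sum.swap)
    also have "\<dots> = (\<Sum>q\<in>R. \<Sum>d\<in>C. \<Sum>c\<in>C. A r d * B d q * A q c * x c)"
      by (intro sum.cong refl sum.swap)
    also have "\<dots> = (\<Sum>d\<in>C. \<Sum>q\<in>R. \<Sum>c\<in>C. A r d * B d q * A q c * x c)"
      by (rule sum.swap)
    also have "\<dots> = (\<Sum>d\<in>C. mat_vec R B (mat_vec C A x) d * A r d)"
      by (simp add: mat_vec_def sum_distrib_left sum_distrib_right mult_ac)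
    finally show ?thesis
      by (simp add: y_def left_diff_distrib sum_subtractf) (simp add: mat_vec_def mult.commute)
  qed
  then have "y c = 0" using full c unfolding full_column_rank_def by blast
  then show ?thesis by (simp add: y_def)
qed

lemma least_squares_perturbation:
  assumes fin: "finite R" "finite C"
    and full: "full_column_rank R C A" and cond: "cond_number_le R C A K"
    and min: "L2_set (\<lambda>r. mat_vec C A X r - b r) R \<le> L2_set (\<lambda>r. mat_vec C A Y r - b r) R"
    and res: "\<And>r. r \<in> R \<Longrightarrow> \<bar>mat_vec C A Y r - b r\<bar> \<le> \<bar>A r0 c0\<bar> * \<epsilon>"
    and r0: "r0 \<in> R" "c0 \<in> C" and c: "c \<in> C" and \<epsilon>: "0 \<le> \<epsilon>"
  shows "\<bar>X c - Y c\<bar> \<le> 2 * K * real (card R) * \<epsilon>"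
proof -
  obtain B where mp: "moore_penrose R C A B" and K: "mat_norm R C A * mat_norm C R B \<le> K"
    using cond unfolding cond_number_le_def by blast
  let ?Z = "\<lambda>c. X c - Y c"
  let ?N = "mat_norm R C A" and ?N' = "mat_norm C R B"
  let ?e = "L2_set (\<lambda>r. mat_vec C A Y r - b r) R"
  have N': "0 \<le> ?N'" by (rule mat_norm_nonneg[OF fin(2,1)])
  have e: "?e \<le> real (card R) * (?N * \<epsilon>)"
  proof -
    have "?e \<le> (\<Sum>r\<in>R. \<bar>mat_vec C A Y r - b r\<bar>)" by (rule L2_set_le_sum_abs)
    also have "\<dots> \<le> (\<Sum>r\<in>R. ?N * \<epsilon>)"
      by (intro sum_mono order_trans[OF res] mult_right_mono entry_le_mat_norm fin r0 \<epsilon>)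
    finally show ?thesis by simp
  qed
  have "L2_set (mat_vec C A ?Z) R =
      L2_set (\<lambda>r. (mat_vec C A X r - b r) + - (mat_vec C A Y r - b r)) R"
    by (intro L2_set_cong) (simp_all add: mat_vec_def right_diff_distrib sum_subtractf)
  also have "\<dots> \<le> L2_set (\<lambda>r. mat_vec C A X r - b r) R + L2_set (\<lambda>r. - (mat_vec C A Y r - b r)) R"
    by (rule L2_set_triangle_ineq)
  also have "L2_set (\<lambda>r. - (mat_vec C A Y r - b r)) R = ?e"
    unfolding L2_set_def power2_minus ..
  finally have Z: "L2_set (mat_vec C A ?Z) R \<le> 2 * ?e" using min by linarith
  have "\<bar>?Z c\<bar> = \<bar>mat_vec R B (mat_vec C A ?Z) c\<bar>"
    by (simp add: moore_penrose_left_inverse[OF fin full mp c])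
  also have "\<dots> \<le> L2_set (mat_vec R B (mat_vec C A ?Z)) C"
    using member_le_L2_set[OF fin(2) c, of "\<lambda>c. \<bar>mat_vec R B (mat_vec C A ?Z) c\<bar>"]
    by (simp add: L2_set_def)
  also have "\<dots> \<le> ?N' * L2_set (mat_vec C A ?Z) R" by (rule mat_norm_bound[OF fin(2,1)])
  also have "\<dots> \<le> ?N' * (2 * (real (card R) * (?N * \<epsilon>)))"
    using Z e N' by (intro mult_left_mono) linarith+
  also have "\<dots> = 2 * (?N * ?N') * real (card R) * \<epsilon>" by simp
  also have "\<dots> \<le> 2 * K * real (card R) * \<epsilon>"
    using K \<epsilon> by (intro mult_right_mono) auto
  finally show ?thesis .
qed

section \<open>Symmetry of partial derivatives\<close>

lemma second_difference:
  fixes g :: "'a::real_normed_vector \<Rightarrow> real"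
  assumes "0 < h"
    and mem: "\<And>\<sigma> \<tau>. \<lbrakk>0 \<le> \<sigma>; \<sigma> \<le> h; 0 \<le> \<tau>; \<tau> \<le> h\<rbrakk> \<Longrightarrow> x + \<sigma> *\<^sub>R d + \<tau> *\<^sub>R e \<in> U"
    and g: "\<And>y. y \<in> U \<Longrightarrow> g differentiable at y"
    and g': "\<And>y. y \<in> U \<Longrightarrow> (\<lambda>y. frechet_derivative g (at y) d) differentiable at y"
  shows "\<exists>\<sigma> \<tau>. 0 < \<sigma> \<and> \<sigma> < h \<and> 0 < \<tau> \<and> \<tau> < h \<and>
    g (x + h *\<^sub>R d + h *\<^sub>R e) - g (x + h *\<^sub>R d) - g (x + h *\<^sub>R e) + g x =
    h * h * frechet_derivative (\<lambda>y. frechet_derivative g (at y) d) (at (x + \<sigma> *\<^sub>R d + \<tau> *\<^sub>R e)) e"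
proof -
  let ?g' = "\<lambda>y. frechet_derivative g (at y) d"
  let ?g'' = "\<lambda>y. frechet_derivative ?g' (at y) e"
  have deriv: "((\<lambda>\<sigma>. F (a + \<sigma> *\<^sub>R v)) has_real_derivative frechet_derivative F (at (a + \<sigma> *\<^sub>R v)) v) (at \<sigma>)"
    if "F differentiable at (a + \<sigma> *\<^sub>R v)" for F :: "'a \<Rightarrow> real" and a v \<sigma>
  proof -
    have F: "(F has_derivative frechet_derivative F (at (a + \<sigma> *\<^sub>R v))) (at (a + \<sigma> *\<^sub>R v))"
      using that frechet_derivative_works by blast
    have "((\<lambda>\<sigma>. a + \<sigma> *\<^sub>R v) has_derivative (\<lambda>t. t *\<^sub>R v)) (at \<sigma>)"
      by (auto intro!: derivative_eq_intros)
    from has_derivative_compose[OF this F]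
    have "((\<lambda>\<sigma>. F (a + \<sigma> *\<^sub>R v)) has_derivative
        (\<lambda>t. frechet_derivative F (at (a + \<sigma> *\<^sub>R v)) (t *\<^sub>R v))) (at \<sigma>)" .
    then show ?thesis
      using linear_frechet_derivative[OF that]
      by (simp add: has_field_derivative_def linear_scale mult.commute[of _ "frechet_derivative _ _ _"] fun_eq_iff mult_commute_abs)
  qed
  have "\<exists>\<sigma>. 0 < \<sigma> \<and> \<sigma> < h \<and>
    (g (x + h *\<^sub>R e + h *\<^sub>R d) - g (x + h *\<^sub>R d)) - (g (x + h *\<^sub>R e + 0 *\<^sub>R d) - g (x + 0 *\<^sub>R d)) =
    (h - 0) * (?g' (x + h *\<^sub>R e + \<sigma> *\<^sub>R d) - ?g' (x + \<sigma> *\<^sub>R d))"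
    using mem[of _ h] mem[of _ 0] \<open>0 < h\<close>
    by (intro MVT2 DERIV_diff deriv g) (simp_all add: add_ac)
  then obtain \<sigma> where \<sigma>: "0 < \<sigma>" "\<sigma> < h" and
    eq1: "g (x + h *\<^sub>R e + h *\<^sub>R d) - g (x + h *\<^sub>R d) - (g (x + h *\<^sub>R e) - g x) =
      h * (?g' (x + h *\<^sub>R e + \<sigma> *\<^sub>R d) - ?g' (x + \<sigma> *\<^sub>R d))"
    by auto
  have "\<exists>\<tau>. 0 < \<tau> \<and> \<tau> < h \<and>
    ?g' (x + \<sigma> *\<^sub>R d + h *\<^sub>R e) - ?g' (x + \<sigma> *\<^sub>R d + 0 *\<^sub>R e) = (h - 0) * ?g'' (x + \<sigma> *\<^sub>R d + \<tau> *\<^sub>R e)"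
    using mem[of \<sigma>] \<sigma> by (intro MVT2 deriv g' \<open>0 < h\<close>) auto
  then obtain \<tau> where "0 < \<tau>" "\<tau> < h" and
    "?g' (x + \<sigma> *\<^sub>R d + h *\<^sub>R e) - ?g' (x + \<sigma> *\<^sub>R d) = h * ?g'' (x + \<sigma> *\<^sub>R d + \<tau> *\<^sub>R e)"
    by auto
  then show ?thesis using eq1 \<sigma> by (intro exI[of _ \<sigma>] exI[of _ \<tau>]) (simp add: add_ac)
qed

lemma mixed_partials_commute:
  fixes g :: "'a::real_normed_vector \<Rightarrow> real"
  assumes U: "open U" "x \<in> U"
    and g: "\<And>y. y \<in> U \<Longrightarrow> g differentiable at y"
    and gd: "\<And>y. y \<in> U \<Longrightarrow> (\<lambda>y. frechet_derivative g (at y) d) differentiable at y"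
    and ge: "\<And>y. y \<in> U \<Longrightarrow> (\<lambda>y. frechet_derivative g (at y) e) differentiable at y"
    and cde: "continuous_on U (\<lambda>y. frechet_derivative (\<lambda>y. frechet_derivative g (at y) d) (at y) e)"
    and ced: "continuous_on U (\<lambda>y. frechet_derivative (\<lambda>y. frechet_derivative g (at y) e) (at y) d)"
  shows "frechet_derivative (\<lambda>y. frechet_derivative g (at y) d) (at x) e =
         frechet_derivative (\<lambda>y. frechet_derivative g (at y) e) (at x) d"
    (is "?D x = ?E x")
proof (rule ccontr)
  assume ne: "?D x \<noteq> ?E x"
  define \<epsilon> where "\<epsilon> = \<bar>?D x - ?E x\<bar> / 2"
  have \<epsilon>: "0 < \<epsilon>" using ne by (simp add: \<epsilon>_def)
  obtain \<delta>0 where \<delta>0: "0 < \<delta>0" "ball x \<delta>0 \<subseteq> U" using U openE by blast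
  have "isCont ?D x" "isCont ?E x"
    using cde ced U continuous_on_eq_continuous_at by blast+
  then obtain \<delta>1 \<delta>2 where \<delta>: "0 < \<delta>1" "\<And>y. dist y x < \<delta>1 \<Longrightarrow> dist (?D y) (?D x) < \<epsilon>"
      "0 < \<delta>2" "\<And>y. dist y x < \<delta>2 \<Longrightarrow> dist (?E y) (?E x) < \<epsilon>"
    unfolding continuous_at_eps_delta using \<epsilon> by metis
  define \<delta> where "\<delta> = min \<delta>0 (min \<delta>1 \<delta>2)"
  define h where "h = \<delta> / (2 * (norm d + norm e + 1))"
  have "0 < \<delta>" using \<delta> \<delta>0 by (simp add: \<delta>_def)
  then have h: "0 < h" by (simp add: h_def add_nonneg_pos)
  have near: "dist (x + \<sigma> *\<^sub>R d + \<tau> *\<^sub>R e) x < \<delta>"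
    if "0 \<le> \<sigma>" "\<sigma> \<le> h" "0 \<le> \<tau>" "\<tau> \<le> h" for \<sigma> \<tau>
  proof -
    have "dist (x + \<sigma> *\<^sub>R d + \<tau> *\<^sub>R e) x \<le> norm (\<sigma> *\<^sub>R d) + norm (\<tau> *\<^sub>R e)"
      using norm_triangle_ineq[of "\<sigma> *\<^sub>R d" "\<tau> *\<^sub>R e"] by (simp add: dist_norm add.assoc)
    also have "\<dots> \<le> h * norm d + h * norm e"
      using that by (simp add: add_mono mult_right_mono)
    also have "\<dots> < h * (2 * (norm d + norm e + 1))"
      using h by (simp add: algebra_simps add_pos_nonneg)
        (smt (verit) mult_nonneg_nonneg norm_ge_zero)
    also have "\<dots> = \<delta>"
      by (simp add: h_def add_nonneg_eq_0_iff)
    finally show ?thesis .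
  qed
  have mem: "x + \<sigma> *\<^sub>R d + \<tau> *\<^sub>R e \<in> U"
    if "0 \<le> \<sigma>" "\<sigma> \<le> h" "0 \<le> \<tau>" "\<tau> \<le> h" for \<sigma> \<tau>
    using near[OF that] \<delta>0 by (auto simp: \<delta>_def dist_commute subset_iff)
  obtain \<sigma> \<tau> where 1: "0 < \<sigma>" "\<sigma> < h" "0 < \<tau>" "\<tau> < h"
    "g (x + h *\<^sub>R d + h *\<^sub>R e) - g (x + h *\<^sub>R d) - g (x + h *\<^sub>R e) + g x =
     h * h * ?D (x + \<sigma> *\<^sub>R d + \<tau> *\<^sub>R e)"
    using second_difference[of h x d e U g, OF h mem g gd] by blast
  have mem': "x + \<sigma> *\<^sub>R e + \<tau> *\<^sub>R d \<in> U"
    if "0 \<le> \<sigma>" "\<sigma> \<le> h" "0 \<le> \<tau>" "\<tau> \<le> h" for \<sigma> \<tau>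
    using mem[of \<tau> \<sigma>] that by (simp add: add_ac)
  obtain \<sigma>' \<tau>' where 2: "0 < \<sigma>'" "\<sigma>' < h" "0 < \<tau>'" "\<tau>' < h"
    "g (x + h *\<^sub>R e + h *\<^sub>R d) - g (x + h *\<^sub>R e) - g (x + h *\<^sub>R d) + g x =
     h * h * ?E (x + \<sigma>' *\<^sub>R e + \<tau>' *\<^sub>R d)"
    using second_difference[of h x e d U g, OF h mem' g ge] by blast
  have swap: "x + \<tau> *\<^sub>R e + \<sigma> *\<^sub>R d = x + \<sigma> *\<^sub>R d + \<tau> *\<^sub>R e" for \<sigma> \<tau> :: real
    by simp
  have "h * h * ?D (x + \<sigma> *\<^sub>R d + \<tau> *\<^sub>R e) = h * h * ?E (x + \<tau>' *\<^sub>R d + \<sigma>' *\<^sub>R e)"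
    using 1(5) 2(5) unfolding swap by linarith
  then have "?D (x + \<sigma> *\<^sub>R d + \<tau> *\<^sub>R e) = ?E (x + \<tau>' *\<^sub>R d + \<sigma>' *\<^sub>R e)"
    using h by simp
  moreover have "dist (?D (x + \<sigma> *\<^sub>R d + \<tau> *\<^sub>R e)) (?D x) < \<epsilon>"
    using near[of \<sigma> \<tau>] 1 by (intro \<delta>) (simp add: \<delta>_def)
  moreover have "dist (?E (x + \<tau>' *\<^sub>R d + \<sigma>' *\<^sub>R e)) (?E x) < \<epsilon>"
    using near[of \<tau>' \<sigma>'] 2 by (intro \<delta>) (simp add: \<delta>_def)
  moreover have False if "u = v" "dist u a < \<bar>a - b\<bar> / 2" "dist v b < \<bar>a - b\<bar> / 2"
    for a b u v :: real
    using dist_triangle_half_r[OF that(2), of b] that(1,3) by (simp add: dist_real_def)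
  ultimately show False unfolding \<epsilon>_def by blast
qed

section \<open>Taylor polynomials in two variables\<close>

lemma iter_partial_Nil [simp]: "iter_partial [] f = f"
  by (simp add: iter_partial_def)

lemma iter_partial_Cons:
  "iter_partial (b # bs) f = (\<lambda>x. frechet_derivative (iter_partial bs f) (at x) b)"
  by (simp add: iter_partial_def)

lemma iter_partial_append: "iter_partial (bs @ cs) f = iter_partial bs (iter_partial cs f)"
  by (simp add: iter_partial_def)

lemma iter_partial_cong:
  assumes "open U" "\<And>x. x \<in> U \<Longrightarrow> f x = g x" "x \<in> U"
  shows "iter_partial bs f x = iter_partial bs g x"
  using assms(3)
proof (induction bs arbitrary: x)
  case Nil
  then show ?case by (simp add: assms(2))
next
  case (Cons b bs)
  have "((iter_partial bs f) has_derivative D) (at x) \<longleftrightarrow> ((iter_partial bs g) has_derivative D) (at x)" for D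
    using Cons has_derivative_transform_within_open[OF _ assms(1) \<open>x \<in> U\<close>] by metis
  then show ?case by (simp add: iter_partial_Cons frechet_derivative_def)
qed

lemma Ck_on_differentiable:
  "\<lbrakk>Ck_on n U f; set bs \<subseteq> Basis; length bs < n; x \<in> U\<rbrakk> \<Longrightarrow> iter_partial bs f differentiable (at x)"
  unfolding Ck_on_def by blast

lemma Ck_on_continuous:
  "\<lbrakk>Ck_on n U f; set bs \<subseteq> Basis; length bs \<le> n\<rbrakk> \<Longrightarrow> continuous_on U (iter_partial bs f)"
  unfolding Ck_on_def by blast

lemma Ck_on_partial:
  assumes "Ck_on (Suc n) U f" "b \<in> Basis"
  shows "Ck_on n U (iter_partial [b] f)"
  unfolding Ck_on_def
proof (intro allI impI conjI ballI)
  fix bs :: "'a list" and x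
  assume bs: "set bs \<subseteq> Basis"
  show "iter_partial bs (iter_partial [b] f) differentiable at x" if "length bs < n" "x \<in> U"
    using Ck_on_differentiable[OF assms(1), of "bs @ [b]"] bs that assms(2)
    by (simp add: iter_partial_append)
  show "continuous_on U (iter_partial bs (iter_partial [b] f))" if "length bs \<le> n"
    using Ck_on_continuous[OF assms(1), of "bs @ [b]"] bs that assms(2)
    by (simp add: iter_partial_append)
qed

lemma derivs_bounded_partial:
  assumes "derivs_bounded (Suc n) M U f" "b \<in> Basis"
  shows "derivs_bounded n M U (iter_partial [b] f)"
  unfolding derivs_bounded_def
proof (intro allI impI ballI)
  fix bs :: "'a list" and x
  assume "set bs \<subseteq> Basis \<and> length bs \<le> n" "x \<in> U"
  then show "norm (iter_partial bs (iter_partial [b] f) x) \<le> M"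
    using assms unfolding derivs_bounded_def
    by (auto dest!: spec[of _ "bs @ [b]"] simp: iter_partial_append)
qed

lemma Ck_on_mono: "\<lbrakk>Ck_on n U f; m \<le> n\<rbrakk> \<Longrightarrow> Ck_on m U f"
  unfolding Ck_on_def by auto

lemma derivs_bounded_mono: "\<lbrakk>derivs_bounded n M U f; m \<le> n\<rbrakk> \<Longrightarrow> derivs_bounded m M U f"
  unfolding derivs_bounded_def by auto

lemma derivs_bounded_nonneg:
  assumes "derivs_bounded n M U f" "x \<in> U"
  shows "0 \<le> M"
  using assms unfolding derivs_bounded_def
  by (auto dest!: spec[of _ "[]"] intro: order_trans[OF norm_ge_zero])

lemma iter_partial_commute:
  fixes f :: "'a::euclidean_space \<Rightarrow> real"
  assumes "open U" "Ck_on n U f" "a \<in> Basis" "b \<in> Basis" "k < n" "x \<in> U"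
  shows "iter_partial (replicate k b @ [a]) f x = iter_partial (a # replicate k b) f x"
  using assms(5,6)
proof (induction k arbitrary: x)
  case 0
  then show ?case by simp
next
  case (Suc k)
  let ?g = "iter_partial (replicate k b) f"
  have rep: "set (replicate k b) \<subseteq> Basis" using assms(4) by auto
  have "iter_partial (replicate (Suc k) b @ [a]) f x = iter_partial [b] (iter_partial (replicate k b @ [a]) f) x"
    by (simp add: iter_partial_Cons)
  also have "\<dots> = iter_partial [b] (iter_partial (a # replicate k b) f) x"
    by (rule iter_partial_cong[OF assms(1) Suc.IH Suc.prems(2)]) (use Suc.prems in auto)
  also have "\<dots> = frechet_derivative (\<lambda>y. frechet_derivative ?g (at y) a) (at x) b"
    by (simp add: iter_partial_Cons)
  also have "\<dots> = frechet_derivative (\<lambda>y. frechet_derivative ?g (at y) b) (at x) a"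
  proof (rule mixed_partials_commute[OF assms(1) \<open>x \<in> U\<close>])
    note diff = Ck_on_differentiable[OF assms(2)]
    show "?g differentiable at y" if "y \<in> U" for y
      using diff[of "replicate k b"] Suc.prems rep that by simp
    show "(\<lambda>y. frechet_derivative ?g (at y) a) differentiable at y" if "y \<in> U" for y
      using diff[of "a # replicate k b"] Suc.prems rep that assms(3) by (simp add: iter_partial_Cons)
    show "(\<lambda>y. frechet_derivative ?g (at y) b) differentiable at y" if "y \<in> U" for y
      using diff[of "b # replicate k b"] Suc.prems rep that assms(4) by (simp add: iter_partial_Cons)
    note cont = Ck_on_continuous[OF assms(2)]
    show "continuous_on U (\<lambda>y. frechet_derivative (\<lambda>y. frechet_derivative ?g (at y) a) (at y) b)"
      using cont[of "b # a # replicate k b"] Suc.prems rep assms(3,4) by (simp add: iter_partial_Cons)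
    show "continuous_on U (\<lambda>y. frechet_derivative (\<lambda>y. frechet_derivative ?g (at y) b) (at y) a)"
      using cont[of "a # b # replicate k b"] Suc.prems rep assms(3,4) by (simp add: iter_partial_Cons)
  qed
  also have "\<dots> = iter_partial (a # replicate (Suc k) b) f x"
    by (simp add: iter_partial_Cons)
  finally show ?case .
qed

abbreviation partial_u :: "(real \<times> real \<Rightarrow> real) \<Rightarrow> real \<times> real \<Rightarrow> real" where
  "partial_u \<equiv> iter_partial [(1, 0)]"

abbreviation partial_v :: "(real \<times> real \<Rightarrow> real) \<Rightarrow> real \<times> real \<Rightarrow> real" where
  "partial_v \<equiv> iter_partial [(0, 1)]"

lemma partials_has_derivative:
  fixes f :: "real \<times> real \<Rightarrow> real"
  assumes "Ck_on n U f" "0 < n" "z \<in> U"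
  shows "(f has_derivative (\<lambda>d. fst d * partial_u f z + snd d * partial_v f z)) (at z)"
proof -
  have diff: "f differentiable at z"
    using Ck_on_differentiable[OF assms(1), of "[]"] assms by simp
  let ?D = "frechet_derivative f (at z)"
  have "?D d = fst d * partial_u f z + snd d * partial_v f z" for d
  proof -
    have "?D d = ?D (fst d *\<^sub>R (1, 0) + snd d *\<^sub>R (0, 1))" by simp
    also have "\<dots> = fst d * ?D (1, 0) + snd d * ?D (0, 1)"
      unfolding linear_add[OF linear_frechet_derivative[OF diff]]
        linear_scale[OF linear_frechet_derivative[OF diff]] by simp
    finally show ?thesis by (simp add: iter_partial_Cons)
  qed
  then have "?D = (\<lambda>d. fst d * partial_u f z + snd d * partial_v f z)" by blast
  then show ?thesis using diff unfolding frechet_derivative_works by metis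
qed

lemma partials_mean_value_bound:
  fixes f :: "real \<times> real \<Rightarrow> real"
  assumes "convex S" "y \<in> S" "z \<in> S"
    and f: "\<And>w. w \<in> S \<Longrightarrow> (f has_derivative (\<lambda>d. fst d * a w + snd d * b w)) (at w)"
    and a: "\<And>w. w \<in> S \<Longrightarrow> \<bar>a w\<bar> \<le> B" and b: "\<And>w. w \<in> S \<Longrightarrow> \<bar>b w\<bar> \<le> B"
  shows "\<bar>f y - f z\<bar> \<le> 2 * B * norm (y - z)"
proof -
  have "norm (f y - f z) \<le> (2 * B) * norm (y - z)"
  proof (rule differentiable_bound[OF assms(1) _ _ assms(2,3)])
    fix w assume w: "w \<in> S"
    show "(f has_derivative (\<lambda>d. fst d * a w + snd d * b w)) (at w within S)"
      using f[OF w] has_derivative_at_withinI by blast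
    show "onorm (\<lambda>d. fst d * a w + snd d * b w) \<le> 2 * B"
    proof (rule onorm_le)
      fix d :: "real \<times> real"
      have "\<bar>fst d * a w\<bar> \<le> norm d * B" "\<bar>snd d * b w\<bar> \<le> norm d * B"
        using a[OF w] b[OF w] norm_fst_le[of "fst d" "snd d"] norm_snd_le[of "snd d" "fst d"]
        by (auto simp: abs_mult intro!: mult_mono)
      then show "norm (fst d * a w + snd d * b w) \<le> 2 * B * norm d"
        by (simp add: algebra_simps)
    qed
  qed
  then show ?thesis by simp
qed

lemma derivs_bounded_lipschitz:
  fixes f :: "real \<times> real \<Rightarrow> real"
  assumes "Ck_on 1 (ball 0 r) f" "derivs_bounded 1 M (ball 0 r) f" "y \<in> ball 0 r" "z \<in> ball 0 r"
  shows "\<bar>f y - f z\<bar> \<le> 2 * M * norm (y - z)"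
proof (rule partials_mean_value_bound[OF convex_ball assms(3,4) partials_has_derivative[OF assms(1)]])
  show "\<bar>partial_u f w\<bar> \<le> M" "\<bar>partial_v f w\<bar> \<le> M" if "w \<in> ball 0 r" for w
    using assms(2) that unfolding derivs_bounded_def
    by (auto simp: Basis_prod_def dest: spec[of _ "[(1, 0)]"] spec[of _ "[(0, 1)]"])
qed auto

definition poly2 :: "nat \<Rightarrow> (nat \<Rightarrow> nat \<Rightarrow> real) \<Rightarrow> real \<times> real \<Rightarrow> real" where
  "poly2 n c z = (\<Sum>(j, k)\<in>{(j, k). j + k < n}. c j k * fst z ^ j * snd z ^ k)"

lemma finite_total_degree_less [simp]: "finite {(j, k). j + k < (n::nat)}"
  by (rule finite_subset[of _ "{..<n} \<times> {..<n}"]) auto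

lemma poly2_cong:
  "(\<And>j k. j + k < n \<Longrightarrow> c j k = d j k) \<Longrightarrow> poly2 n c z = poly2 n d z"
  unfolding poly2_def by (intro sum.cong) auto

lemma poly2_partial_u:
  "(\<Sum>(j, k)\<in>{(j, k). j + k < Suc n}. c j k * (real j * u ^ (j - 1)) * v ^ k) =
   poly2 n (\<lambda>j k. real (Suc j) * c (Suc j) k) (u, v)"
proof -
  let ?g = "\<lambda>(j, k). c j k * (real j * u ^ (j - 1)) * v ^ k"
  let ?i = "\<lambda>(j, k). (Suc j, k)"
  let ?T = "{(j, k). j + k < n}"
  have zero: "?g x = 0" if "x \<in> {(j, k). j + k < Suc n} - ?i ` ?T" for x
    using that by (cases "fst x"; cases x) (auto simp: image_iff)
  have "sum ?g {(j, k). j + k < Suc n} = sum ?g (?i ` ?T)"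
    using zero by (intro sum.mono_neutral_right) auto
  also have "\<dots> = sum (?g \<circ> ?i) ?T"
    by (rule sum.reindex) (auto intro: inj_onI)
  also have "\<dots> = poly2 n (\<lambda>j k. real (Suc j) * c (Suc j) k) (u, v)"
    unfolding poly2_def by (intro sum.cong) auto
  finally show ?thesis .
qed

lemma poly2_partial_v:
  "(\<Sum>(j, k)\<in>{(j, k). j + k < Suc n}. c j k * u ^ j * (real k * v ^ (k - 1))) =
   poly2 n (\<lambda>j k. real (Suc k) * c j (Suc k)) (u, v)"
proof -
  let ?g = "\<lambda>(j, k). c j k * u ^ j * (real k * v ^ (k - 1))"
  let ?i = "\<lambda>(j, k). (j, Suc k)"
  let ?T = "{(j, k). j + k < n}"
  have zero: "?g x = 0" if "x \<in> {(j, k). j + k < Suc n} - ?i ` ?T" for x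
    using that by (cases "snd x"; cases x) (auto simp: image_iff)
  have "sum ?g {(j, k). j + k < Suc n} = sum ?g (?i ` ?T)"
    using zero by (intro sum.mono_neutral_right) auto
  also have "\<dots> = sum (?g \<circ> ?i) ?T"
    by (rule sum.reindex) (auto intro: inj_onI)
  also have "\<dots> = poly2 n (\<lambda>j k. real (Suc k) * c j (Suc k)) (u, v)"
    unfolding poly2_def by (intro sum.cong) auto
  finally show ?thesis .
qed

lemma poly2_has_derivative:
  "(poly2 (Suc n) c has_derivative
     (\<lambda>d. fst d * poly2 n (\<lambda>j k. real (Suc j) * c (Suc j) k) z +
          snd d * poly2 n (\<lambda>j k. real (Suc k) * c j (Suc k)) z)) (at z)"
proof -
  have "(poly2 (Suc n) c has_derivative
      (\<lambda>d. \<Sum>(j, k)\<in>{(j, k). j + k < Suc n}.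
        fst d * (c j k * (real j * fst z ^ (j - 1)) * snd z ^ k) +
        snd d * (c j k * fst z ^ j * (real k * snd z ^ (k - 1))))) (at z)"
    unfolding poly2_def case_prod_unfold
    by (auto intro!: derivative_eq_intros simp: algebra_simps)
  then show ?thesis
    using poly2_partial_u[of c "fst z" "snd z" n] poly2_partial_v[of c "fst z" "snd z" n]
    by (simp add: case_prod_unfold sum.distrib flip: sum_distrib_left)
qed

lemma poly2_at_0: "poly2 (Suc n) c 0 = c 0 0"
proof -
  have "poly2 (Suc n) c 0 = (\<Sum>(j, k)\<in>{(0, 0)}. c j k * 0 ^ j * 0 ^ k)"
    unfolding poly2_def by (intro sum.mono_neutral_cong_right) auto
  then show ?thesis by simp
qed

definition taylor_coeff :: "(real \<times> real \<Rightarrow> real) \<Rightarrow> nat \<Rightarrow> nat \<Rightarrow> real" where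
  "taylor_coeff f j k =
     iter_partial (replicate j (1, 0) @ replicate k (0, 1)) f 0 / (fact j * fact k)"

lemma taylor_coeff_partial_u:
  assumes "open U" "0 \<in> U" "Ck_on n U f" "k < n"
  shows "taylor_coeff (partial_u f) j k = real (Suc j) * taylor_coeff f (Suc j) k"
proof -
  have "iter_partial (replicate k (0, 1)) (partial_u f) x = iter_partial ((1, 0) # replicate k (0, 1)) f x"
    if "x \<in> U" for x
    using iter_partial_commute[OF assms(1,3) _ _ assms(4) that, of "(1, 0)" "(0, 1)"]
    by (simp add: iter_partial_append Basis_prod_def)
  then have "iter_partial (replicate j (1, 0)) (iter_partial (replicate k (0, 1)) (partial_u f)) 0 =
      iter_partial (replicate j (1, 0)) (iter_partial ((1, 0) # replicate k (0, 1)) f) 0"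
    by (rule iter_partial_cong[OF assms(1) _ assms(2)])
  also have "\<dots> = iter_partial (replicate (Suc j) (1, 0) @ replicate k (0, 1)) f 0"
    unfolding iter_partial_append[symmetric] by (simp add: replicate_app_Cons_same)
  finally show ?thesis
    by (simp add: taylor_coeff_def iter_partial_append field_simps del: of_nat_Suc)
qed

lemma taylor_coeff_partial_v:
  "taylor_coeff (partial_v f) j k = real (Suc k) * taylor_coeff f j (Suc k)"
proof -
  have "iter_partial (replicate j (1, 0) @ replicate (Suc k) (0, 1)) f =
      iter_partial (replicate j (1, 0) @ replicate k (0, 1)) (partial_v f)"
    unfolding iter_partial_append[symmetric]
    by (simp add: replicate_append_same)
  then show ?thesis
    by (simp add: taylor_coeff_def field_simps del: of_nat_Suc replicate_Suc)
qed

text \<open>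
  By symmetry of the partial derivatives, differentiating a Taylor polynomial of \<open>f\<close> gives the Taylor
  polynomial of the derivative, so the induction hypothesis bounds the gradient of the remainder.
\<close>

lemma taylor_remainder:
  assumes "Ck_on n (ball 0 r) f" "derivs_bounded n M (ball 0 r) f" "z \<in> ball 0 r"
  shows "\<bar>f z - poly2 n (taylor_coeff f) z\<bar> \<le> 2 ^ n * M * norm z ^ n"
  using assms
proof (induction n arbitrary: f z)
  case 0
  then show ?case
    by (auto simp: derivs_bounded_def poly2_def)
next
  case (Suc n)
  have M: "0 \<le> M" by (rule derivs_bounded_nonneg[OF Suc.prems(2,3)])
  have r: "0 < r" using Suc.prems(3) le_less_trans[OF norm_ge_zero[of z], of r] by simp
  let ?R = "\<lambda>z. f z - poly2 (Suc n) (taylor_coeff f) z"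
  let ?u = "\<lambda>z. partial_u f z - poly2 n (taylor_coeff (partial_u f)) z"
  let ?v = "\<lambda>z. partial_v f z - poly2 n (taylor_coeff (partial_v f)) z"
  have sub: "cball 0 (norm z) \<subseteq> ball (0 :: real \<times> real) r" using Suc.prems(3) by auto
  have pu: "poly2 n (taylor_coeff (partial_u f)) w =
      poly2 n (\<lambda>j k. real (Suc j) * taylor_coeff f (Suc j) k) w" for w
    using Suc.prems(1) r by (intro poly2_cong taylor_coeff_partial_u) auto
  have pv: "poly2 n (taylor_coeff (partial_v f)) w =
      poly2 n (\<lambda>j k. real (Suc k) * taylor_coeff f j (Suc k)) w" for w
    by (intro poly2_cong taylor_coeff_partial_v)
  have basis: "(1, 0) \<in> (Basis :: (real \<times> real) set)" "(0, 1) \<in> (Basis :: (real \<times> real) set)"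
    by (auto simp: Basis_prod_def)
  have *: "\<bar>iter_partial [b] f w - poly2 n (taylor_coeff (iter_partial [b] f)) w\<bar> \<le> 2 ^ n * M * norm z ^ n"
    if w: "w \<in> cball 0 (norm z)" and b: "b \<in> Basis" for w b :: "real \<times> real"
  proof -
    have "\<bar>iter_partial [b] f w - poly2 n (taylor_coeff (iter_partial [b] f)) w\<bar> \<le> 2 ^ n * M * norm w ^ n"
      using w sub by (intro Suc.IH Ck_on_partial derivs_bounded_partial Suc.prems b) auto
    also have "\<dots> \<le> 2 ^ n * M * norm z ^ n"
      using w M by (intro mult_left_mono power_mono) auto
    finally show ?thesis .
  qed
  have "\<bar>?R z - ?R 0\<bar> \<le> 2 * (2 ^ n * M * norm z ^ n) * norm (z - 0)"
  proof (rule partials_mean_value_bound[where a = ?u and b = ?v])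
    fix w :: "real \<times> real"
    assume w: "w \<in> cball 0 (norm z)"
    have "(f has_derivative (\<lambda>d. fst d * partial_u f w + snd d * partial_v f w)) (at w)"
      using w sub by (intro partials_has_derivative[OF Suc.prems(1)]) auto
    then show "(?R has_derivative (\<lambda>d. fst d * ?u w + snd d * ?v w)) (at w)"
      unfolding pu pv
      by (rule has_derivative_eq_rhs[OF has_derivative_diff[OF _ poly2_has_derivative]])
        (simp add: algebra_simps)
    show "\<bar>?u w\<bar> \<le> 2 ^ n * M * norm z ^ n" "\<bar>?v w\<bar> \<le> 2 ^ n * M * norm z ^ n"
      using *[OF w] basis by auto
  qed auto
  moreover have "?R 0 = 0"
    by (simp add: poly2_at_0 taylor_coeff_def)
  ultimately show ?case by (simp add: mult_ac)
qed

section \<open>Consistency of the fitting equations\<close>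

definition orthonormal_frame :: "real^3 \<Rightarrow> real^3 \<Rightarrow> real^3 \<Rightarrow> bool" where
  "orthonormal_frame s t m \<longleftrightarrow> norm s = 1 \<and> norm t = 1 \<and> norm m = 1 \<and>
     s \<bullet> t = 0 \<and> s \<bullet> m = 0 \<and> t \<bullet> m = 0"

lemma orthonormal_frame_expansion:
  assumes "orthonormal_frame s t m"
  shows "w = (s \<bullet> w) *\<^sub>R s + (t \<bullet> w) *\<^sub>R t + (m \<bullet> w) *\<^sub>R m"
proof -
  define v where "v = w - ((s \<bullet> w) *\<^sub>R s + (t \<bullet> w) *\<^sub>R t + (m \<bullet> w) *\<^sub>R m)"
  have ip: "s \<bullet> s = 1" "t \<bullet> t = 1" "m \<bullet> m = 1" "s \<bullet> t = 0" "s \<bullet> m = 0" "t \<bullet> m = 0"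
    "t \<bullet> s = 0" "m \<bullet> s = 0" "m \<bullet> t = 0"
    using assms by (auto simp: orthonormal_frame_def norm_eq_1 inner_commute)
  then have ne: "s \<noteq> t" "s \<noteq> m" "t \<noteq> m" "s \<noteq> 0" "t \<noteq> 0" "m \<noteq> 0" by auto
  have "pairwise orthogonal {s, t, m}"
    using ip by (auto simp: pairwise_def orthogonal_def)
  then have "independent {s, t, m}"
    using ne by (intro pairwise_orthogonal_independent) auto
  then have "UNIV \<subseteq> span {s, t, m}"
    using ne by (intro card_ge_dim_independent) auto
  then have "orthogonal v v"
    using ip by (intro orthogonal_to_span[of v "{s, t, m}"])
      (auto simp: v_def orthogonal_def inner_diff_left inner_add_left inner_diff_right inner_add_right
        inner_commute)
  then show ?thesis by (simp add: v_def orthogonal_def)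
qed

lemma orthonormal_frame_norm:
  assumes "orthonormal_frame s t m"
  shows "(norm w)\<^sup>2 = (s \<bullet> w)\<^sup>2 + (t \<bullet> w)\<^sup>2 + (m \<bullet> w)\<^sup>2"
proof -
  have "w \<bullet> w = w \<bullet> ((s \<bullet> w) *\<^sub>R s + (t \<bullet> w) *\<^sub>R t + (m \<bullet> w) *\<^sub>R m)"
    using orthonormal_frame_expansion[OF assms, of w] by simp
  then show ?thesis
    unfolding power2_norm_eq_inner by (simp add: inner_add_right inner_commute power2_eq_square)
qed

lemma norm_frame_le:
  assumes "orthonormal_frame s t m"
  shows "norm (s \<bullet> w, t \<bullet> w) \<le> norm w"
  using orthonormal_frame_norm[OF assms, of w]
  by (simp add: norm_Pair real_le_lsqrt)

lemma norm_uv_le: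
  assumes "orthonormal_frame (svec H x) (tvec H x) (mvec H x)"
  shows "norm (uv H x y) \<le> dist x y" "norm (uv H x y - uv H x y') \<le> dist y y'"
  using norm_frame_le[OF assms, of "y - x"] norm_frame_le[OF assms, of "y - y'"]
  by (simp_all add: uv_def dist_norm norm_minus_commute inner_diff_right)

lemma normal_perp_graph:
  assumes fr: "orthonormal_frame (svec H x) (tvec H x) (mvec H x)"
    and lh: "local_height \<Gamma> H x r f" and nf: "unit_normal_field \<Gamma> \<nu>"
    and y: "y \<in> \<Gamma> \<inter> ball x r"
    and f: "(f has_derivative f') (at (uv H x y))"
  shows "\<nu> y \<bullet> (fst d *\<^sub>R svec H x + snd d *\<^sub>R tvec H x + f' d *\<^sub>R mvec H x) = 0"
proof -
  let ?s = "svec H x" and ?t = "tvec H x" and ?m = "mvec H x" and ?z = "uv H x y"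
  let ?\<phi> = "\<lambda>z. x + fst z *\<^sub>R ?s + snd z *\<^sub>R ?t + f z *\<^sub>R ?m"
  define \<gamma> where "\<gamma> = (\<lambda>\<tau>::real. ?\<phi> (?z + \<tau> *\<^sub>R d))"
  have "f ?z = ?m \<bullet> (y - x)" using lh y by (auto simp: local_height_def)
  then have "\<gamma> 0 = x + (y - x)"
    using orthonormal_frame_expansion[OF fr, of "y - x"] by (simp add: \<gamma>_def uv_def add.assoc)
  then have \<gamma>0: "\<gamma> 0 = y" by simp
  have z: "?z \<in> ball 0 r"
    using norm_uv_le(1)[OF fr, of y] y by auto
  have "((\<lambda>\<tau>. ?z + \<tau> *\<^sub>R d) \<longlongrightarrow> ?z + 0 *\<^sub>R d) (at (0::real))"
    by (intro tendsto_intros)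
  then have "\<forall>\<^sub>F \<tau> in at (0::real). ?z + \<tau> *\<^sub>R d \<in> ball 0 r"
    using z by (intro topological_tendstoD) auto
  then have ev: "\<forall>\<^sub>F \<tau> in at (0::real). \<gamma> \<tau> \<in> \<Gamma>"
    by (rule eventually_mono) (use lh in \<open>unfold \<gamma>_def local_height_def, blast\<close>)
  have f0: "(f has_derivative f') (at (?z + 0 *\<^sub>R d))" using f by simp
  have "((\<lambda>\<tau>. ?z + \<tau> *\<^sub>R d) has_derivative (\<lambda>\<tau>. \<tau> *\<^sub>R d)) (at (0::real))"
    by (auto intro!: derivative_eq_intros)
  from has_derivative_compose[OF this f0]
  have "((\<lambda>\<tau>. f (?z + \<tau> *\<^sub>R d)) has_derivative (\<lambda>\<tau>. f' (\<tau> *\<^sub>R d))) (at (0::real))" .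
  then have "((\<lambda>\<tau>. f (?z + \<tau> *\<^sub>R d)) has_vector_derivative f' d) (at 0)"
    using linear_scale[OF has_derivative_linear[OF f]] by (simp add: has_vector_derivative_def)
  then have "(\<gamma> has_vector_derivative (fst d *\<^sub>R ?s + snd d *\<^sub>R ?t + f' d *\<^sub>R ?m)) (at 0)"
    unfolding \<gamma>_def
    by (auto intro!: derivative_eq_intros simp: has_real_derivative_iff_has_vector_derivative)
  then have "tangent_vector \<Gamma> y (fst d *\<^sub>R ?s + snd d *\<^sub>R ?t + f' d *\<^sub>R ?m)"
    unfolding tangent_vector_def using \<gamma>0 ev by blast
  then show ?thesis using nf y by (auto simp: unit_normal_field_def)
qed

lemma ratio_perturbation:
  fixes a :: real
  assumes \<delta>: "\<bar>\<alpha> - a\<bar> \<le> \<delta>" "\<bar>\<gamma> - g\<bar> \<le> \<delta>" and 1: "\<bar>a\<bar> \<le> 1" "\<bar>g\<bar> \<le> 1"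
    and L: "1 \<le> L * \<bar>g\<bar>" "2 * \<delta> * L \<le> 1" "0 < L"
  shows "\<bar>\<alpha> / \<gamma> - a / g\<bar> \<le> 4 * L\<^sup>2 * \<delta>"
proof -
  have "L * \<bar>g\<bar> \<le> L * (\<bar>\<gamma>\<bar> + \<delta>)" using \<delta>(2) L(3) by (intro mult_left_mono) auto
  then have \<gamma>: "1 \<le> 2 * L * \<bar>\<gamma>\<bar>" using L by (simp add: algebra_simps)
  have nz: "\<gamma> \<noteq> 0" "g \<noteq> 0" using \<gamma> L by auto
  have "1 \<le> (2 * L * \<bar>\<gamma>\<bar>) * (L * \<bar>g\<bar>)" using mult_mono[OF \<gamma> L(1)] \<gamma> by simp
  then have prod: "1 \<le> 2 * L\<^sup>2 * \<bar>\<gamma> * g\<bar>" by (simp add: abs_mult power2_eq_square mult_ac)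
  have "\<bar>\<alpha> * g - a * \<gamma>\<bar> = \<bar>(\<alpha> - a) * g + a * (g - \<gamma>)\<bar>" by (simp add: algebra_simps)
  also have "\<dots> \<le> \<bar>\<alpha> - a\<bar> * \<bar>g\<bar> + \<bar>a\<bar> * \<bar>g - \<gamma>\<bar>"
    using abs_triangle_ineq by (simp flip: abs_mult)
  also have "\<dots> \<le> \<delta> * 1 + 1 * \<delta>"
    using \<delta> 1 by (intro add_mono mult_mono) auto
  finally have num: "\<bar>\<alpha> * g - a * \<gamma>\<bar> \<le> 2 * \<delta>" by simp
  have "\<bar>\<alpha> / \<gamma> - a / g\<bar> = \<bar>\<alpha> * g - a * \<gamma>\<bar> / \<bar>\<gamma> * g\<bar>"
    using nz by (simp add: diff_frac_eq abs_divide)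
  also have "\<dots> \<le> 2 * \<delta> / \<bar>\<gamma> * g\<bar>"
    using num by (rule divide_right_mono) simp
  also have "\<dots> \<le> 4 * L\<^sup>2 * \<delta>"
    using mult_left_mono[OF prod, of "2 * \<delta>"] \<delta> nz by (simp add: field_simps)
  finally show ?thesis .
qed

lemma fit_cols_altdef: "fit_cols p = {(j, k). j + k < Suc p}"
  by (auto simp: fit_cols_def)

definition taylor_solution :: "real \<Rightarrow> (real \<times> real \<Rightarrow> real) \<Rightarrow> nat \<times> nat \<Rightarrow> real" where
  "taylor_solution h f = (\<lambda>(j, k). h ^ (j + k) * taylor_coeff f j k)"

lemma mat_vec_vandermonde_taylor:
  assumes h: "hsize H \<noteq> 0"
  shows "mat_vec (fit_cols p) (vandermonde H x) (taylor_solution (hsize H) f) (y, Value) =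
         poly2 (Suc p) (taylor_coeff f) (uv H x y)" (is ?A)
    and "mat_vec (fit_cols p) (vandermonde H x) (taylor_solution (hsize H) f) (y, DerivU) =
         hsize H * poly2 p (\<lambda>j k. real (Suc j) * taylor_coeff f (Suc j) k) (uv H x y)" (is ?B)
    and "mat_vec (fit_cols p) (vandermonde H x) (taylor_solution (hsize H) f) (y, DerivV) =
         hsize H * poly2 p (\<lambda>j k. real (Suc k) * taylor_coeff f j (Suc k)) (uv H x y)" (is ?C)
proof -
  obtain u v where uv: "uv H x y = (u, v)" by fastforce
  let ?h = "hsize H" and ?c = "taylor_coeff f"
  have pw: "real j * (w / ?h) ^ (j - 1) * ?h ^ j = ?h * (real j * w ^ (j - 1))" for j w
    using h by (cases j) (simp_all add: power_divide field_simps)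
  have pw': "(w / ?h) ^ j * ?h ^ j = w ^ j" for j w
    using h by (simp add: power_divide)
  show ?A
    unfolding mat_vec_def uv poly2_def fit_cols_altdef taylor_solution_def
  proof (intro sum.cong refl, clarify)
    fix j k
    have "(u / ?h) ^ j * (v / ?h) ^ k * (?h ^ (j + k) * ?c j k) =
        ((u / ?h) ^ j * ?h ^ j) * ((v / ?h) ^ k * ?h ^ k) * ?c j k"
      by (simp add: power_add mult_ac)
    also have "\<dots> = ?c j k * fst (u, v) ^ j * snd (u, v) ^ k"
      unfolding pw' by (simp add: mult_ac)
    finally show "vandermonde H x (y, Value) (j, k) * (?h ^ (j + k) * ?c j k) =
        ?c j k * fst (u, v) ^ j * snd (u, v) ^ k"
      by (simp add: uv)
  qed
  show ?B
    unfolding mat_vec_def uv poly2_partial_u[symmetric] fit_cols_altdef taylor_solution_def sum_distrib_left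
  proof (intro sum.cong refl, clarify)
    fix j k
    have "real j * (u / ?h) ^ (j - 1) * (v / ?h) ^ k * (?h ^ (j + k) * ?c j k) =
        (real j * (u / ?h) ^ (j - 1) * ?h ^ j) * ((v / ?h) ^ k * ?h ^ k) * ?c j k"
      by (simp add: power_add mult_ac)
    also have "\<dots> = ?h * (?c j k * (real j * u ^ (j - 1)) * v ^ k)"
      unfolding pw pw' by (simp add: mult_ac)
    finally show "vandermonde H x (y, DerivU) (j, k) * (?h ^ (j + k) * ?c j k) =
        ?h * (?c j k * (real j * u ^ (j - 1)) * v ^ k)"
      by (simp add: uv)
  qed
  show ?C
    unfolding mat_vec_def uv poly2_partial_v[symmetric] fit_cols_altdef taylor_solution_def sum_distrib_left
  proof (intro sum.cong refl, clarify)
    fix j k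
    have "real k * (u / ?h) ^ j * (v / ?h) ^ (k - 1) * (?h ^ (j + k) * ?c j k) =
        ((u / ?h) ^ j * ?h ^ j) * (real k * (v / ?h) ^ (k - 1) * ?h ^ k) * ?c j k"
      by (simp add: power_add mult_ac)
    also have "\<dots> = ?h * (?c j k * u ^ j * (real k * v ^ (k - 1)))"
      unfolding pw pw' by (simp add: mult_ac)
    finally show "vandermonde H x (y, DerivV) (j, k) * (?h ^ (j + k) * ?c j k) =
        ?h * (?c j k * u ^ j * (real k * v ^ (k - 1)))"
      by (simp add: uv)
  qed
qed

lemma fit_consistency:
  fixes H :: hcmf
  defines "h \<equiv> hsize H"
  assumes fr: "orthonormal_frame (svec H x) (tvec H x) (mvec H x)"
    and lh: "local_height \<Gamma> H x r f" and nf: "unit_normal_field \<Gamma> \<nu>"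
    and Ck: "Ck_on (Suc p) (ball 0 r) f" and bd: "derivs_bounded (Suc p) M (ball 0 r) f"
    and p: "1 \<le> p" and h: "0 < h" "h \<le> 1"
    and y': "y' \<in> \<Gamma>" and yy': "dist y y' \<le> E * h ^ Suc p" and xy: "dist x y \<le> D * h"
    and nrm: "norm (nrm H y - \<nu> y') \<le> N * h ^ p"
    and small: "(D + E) * h < r" "2 * (1 + 2 * M) * N * h \<le> 1"
  shows "\<bar>mat_vec (fit_cols p) (vandermonde H x) (taylor_solution h f) (y, e) - fit_rhs H x (y, e)\<bar>
    \<le> (2 ^ Suc p * M * D ^ Suc p + 2 ^ p * M * D ^ p + 4 * M * E + E + 4 * (1 + 2 * M)\<^sup>2 * N) * h ^ Suc p"
    (is "_ \<le> ?K * _")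
proof -
  let ?s = "svec H x" and ?t = "tvec H x" and ?m = "mvec H x"
  define z z' where "z = uv H x y" and "z' = uv H x y'"
  have hp: "0 < h ^ n" for n using h by simp
  have hle: "h ^ Suc p \<le> h" "h ^ p \<le> h" "h ^ Suc p \<le> h ^ p"
    using h p power_decreasing[of 1 "Suc p" h] power_decreasing[of 1 p h] power_decreasing[of p "Suc p" h] by auto
  have D: "0 \<le> D" using xy h zero_le_dist[of x y] by (metis order_trans zero_le_mult_iff not_le)
  have E: "0 \<le> E" using yy' hp[of "Suc p"] zero_le_dist[of y y'] by (metis order_trans zero_le_mult_iff not_le)
  have N: "0 \<le> N" using nrm hp[of p] norm_ge_zero[of "nrm H y - \<nu> y'"] by (metis order_trans zero_le_mult_iff not_le)
  have Eh: "E * h ^ Suc p \<le> E * h" "E * h ^ Suc p \<le> E * h ^ p" using E hle by (auto intro: mult_left_mono)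
  have y'x: "dist x y' < r"
    using dist_triangle[of x y' y] xy yy' Eh small by (simp add: algebra_simps)
  then have y'b: "y' \<in> \<Gamma> \<inter> ball x r" using y' by simp
  have "dist x y < r"
    using xy small(1) mult_nonneg_nonneg[OF E less_imp_le[OF h(1)]] unfolding distrib_right by linarith
  then have z: "z \<in> ball 0 r" "z' \<in> ball 0 r" "norm z \<le> D * h"
    using norm_uv_le(1)[OF fr, of y] norm_uv_le(1)[OF fr, of y'] y'x xy by (auto simp: z_def z'_def)
  have M: "0 \<le> M" by (rule derivs_bounded_nonneg[OF bd z(1)])
  have zz': "norm (z - z') \<le> E * h ^ Suc p"
    using norm_uv_le(2)[OF fr, of y y'] yy' by (simp add: z_def z'_def)
  have basis: "(1, 0) \<in> (Basis :: (real \<times> real) set)" "(0, 1) \<in> (Basis :: (real \<times> real) set)"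
    by (auto simp: Basis_prod_def)
  have lip: "\<bar>g z - g z'\<bar> \<le> 2 * M * (E * h ^ Suc p)"
    if "Ck_on 1 (ball 0 r) g" "derivs_bounded 1 M (ball 0 r) g" for g
    using derivs_bounded_lipschitz[OF that z(1,2)] mult_left_mono[OF zz', of "2 * M"] M by linarith
  have taylor: "\<bar>g z - poly2 n (taylor_coeff g) z\<bar> \<le> 2 ^ n * M * D ^ n * h ^ n"
    if "Ck_on n (ball 0 r) g" "derivs_bounded n M (ball 0 r) g" for g n
  proof -
    have "2 ^ n * M * norm z ^ n \<le> 2 ^ n * M * (D * h) ^ n"
      using M z(3) by (intro mult_left_mono power_mono) auto
    then show ?thesis using taylor_remainder[OF that z(1)] by (simp add: power_mult_distrib mult_ac)
  qed

  note rows = mat_vec_vandermonde_taylor[of H p x f y, folded h_def z_def, OF less_imp_neq[OF h(1), symmetric]]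
  have bounds: "(2 ^ Suc p * M * D ^ Suc p + 2 * M * E + E) * h ^ Suc p \<le> ?K * h ^ Suc p"
    "(2 ^ p * M * D ^ p + 2 * M * E + 4 * (1 + 2 * M)\<^sup>2 * N) * h ^ Suc p \<le> ?K * h ^ Suc p"
    using M D E N h by (auto intro!: mult_right_mono)

  define a b g where "a = ?s \<bullet> \<nu> y'" and "b = ?t \<bullet> \<nu> y'" and "g = ?m \<bullet> \<nu> y'"
  define fu fv where "fu = partial_u f z'" and "fv = partial_v f z'"
  have "(f has_derivative (\<lambda>d. fst d * fu + snd d * fv)) (at z')"
    unfolding fu_def fv_def by (rule partials_has_derivative[OF Ck _ z(2)]) simp
  note perp = normal_perp_graph[OF fr lh nf y'b this[unfolded z'_def]]
  have ab: "a = - fu * g" "b = - fv * g"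
    using perp[of "(1, 0)"] perp[of "(0, 1)"]
    by (simp_all add: a_def b_def g_def inner_add_right inner_commute)
  have "norm (\<nu> y') = 1" using nf y' by (simp add: unit_normal_field_def)
  then have abg: "a\<^sup>2 + b\<^sup>2 + g\<^sup>2 = 1"
    using orthonormal_frame_norm[OF fr, of "\<nu> y'"] by (simp add: a_def b_def g_def)
  then have abg1: "\<bar>a\<bar> \<le> 1" "\<bar>b\<bar> \<le> 1" "\<bar>g\<bar> \<le> 1"
    by (auto simp: abs_square_le_1[symmetric]) (smt (verit) zero_le_power2)+
  have fuv: "\<bar>fu\<bar> \<le> M" "\<bar>fv\<bar> \<le> M"
    using bd z(2) basis unfolding derivs_bounded_def fu_def fv_def
    by (auto dest: spec[of _ "[(1, 0)]"] spec[of _ "[(0, 1)]"])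
  have g: "1 \<le> (1 + 2 * M) * \<bar>g\<bar>"
  proof (rule power2_le_imp_le)
    have "fu\<^sup>2 \<le> M\<^sup>2" "fv\<^sup>2 \<le> M\<^sup>2" using fuv M by (simp_all add: abs_le_square_iff[symmetric])
    moreover have "(1 + 2 * M)\<^sup>2 = 1 + 4 * M + 4 * M\<^sup>2"
      by (simp add: power2_eq_square algebra_simps)
    ultimately have "1 + fu\<^sup>2 + fv\<^sup>2 \<le> (1 + 2 * M)\<^sup>2"
      using M zero_le_power2[of M] by linarith
    then have "(1 + fu\<^sup>2 + fv\<^sup>2) * g\<^sup>2 \<le> (1 + 2 * M)\<^sup>2 * g\<^sup>2" by (rule mult_right_mono) simp
    moreover have "(1 + fu\<^sup>2 + fv\<^sup>2) * g\<^sup>2 = 1"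
      using abg unfolding ab by (simp add: algebra_simps power_mult_distrib)
    ultimately show "1\<^sup>2 \<le> ((1 + 2 * M) * \<bar>g\<bar>)\<^sup>2" by (simp add: power_mult_distrib)
  qed (use M in simp)
  have pert: "\<bar>w \<bullet> nrm H y - w \<bullet> \<nu> y'\<bar> \<le> N * h ^ p" if "norm w = 1" for w
    using Cauchy_Schwarz_ineq2[of w "nrm H y - \<nu> y'"] nrm that by (simp add: inner_diff_right)
  have frn: "norm ?s = 1" "norm ?t = 1" "norm ?m = 1" using fr by (auto simp: orthonormal_frame_def)
  have "2 * (N * h ^ p) * (1 + 2 * M) \<le> 2 * (N * h) * (1 + 2 * M)"
    using hle N M by (intro mult_left_mono mult_right_mono) auto
  then have sm: "2 * (N * h ^ p) * (1 + 2 * M) \<le> 1" using small(2) by (simp add: mult_ac)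
  have ratio: "\<bar>(w \<bullet> nrm H y) / (?m \<bullet> nrm H y) - (w \<bullet> \<nu> y') / g\<bar> \<le> 4 * (1 + 2 * M)\<^sup>2 * (N * h ^ p)"
    if "norm w = 1" "\<bar>w \<bullet> \<nu> y'\<bar> \<le> 1" for w
    using pert[OF that(1)] pert[OF frn(3)] that(2) abg1(3) g sm M
    by (intro ratio_perturbation) (auto simp: g_def)
  have g0: "g \<noteq> 0" using g by auto
  have abs_row: "h * \<bar>b + c\<bar> = \<bar>h * b - - h * c\<bar>" for b c
    using h by (simp add: abs_mult flip: distrib_left)

  \<comment> \<open>Both derivative rows: \<open>- (w \<bullet> \<nu> y') / g\<close> is the slope of \<open>f\<close> at \<open>z'\<close> in the direction of \<open>w\<close>.\<close>
  have deriv_row: "\<bar>h * poly2 p (taylor_coeff (iter_partial [d] f)) z -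
      - h * ((w \<bullet> nrm H y) / (?m \<bullet> nrm H y))\<bar> \<le> ?K * h ^ Suc p"
    if d: "d \<in> Basis" and w: "norm w = 1" "\<bar>w \<bullet> \<nu> y'\<bar> \<le> 1"
      and slope: "iter_partial [d] f z' = - ((w \<bullet> \<nu> y') / g)" for d w
  proof -
    let ?fd = "iter_partial [d] f"
    have Ckd: "Ck_on p (ball 0 r) ?fd" "derivs_bounded p M (ball 0 r) ?fd"
      by (rule Ck_on_partial[OF Ck d], rule derivs_bounded_partial[OF bd d])
    have 1: "\<bar>?fd z - poly2 p (taylor_coeff ?fd) z\<bar> \<le> 2 ^ p * M * D ^ p * h ^ p"
      by (rule taylor[OF Ckd])
    have "\<bar>?fd z - ?fd z'\<bar> \<le> 2 * M * (E * h ^ Suc p)"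
      using Ckd p by (intro lip) (auto intro: Ck_on_mono derivs_bounded_mono)
    also have "\<dots> \<le> 2 * M * (E * h ^ p)"
      using M by (intro mult_left_mono[OF Eh(2)]) auto
    finally have 2: "\<bar>?fd z - ?fd z'\<bar> \<le> 2 * M * (E * h ^ p)" .
    have "\<bar>poly2 p (taylor_coeff ?fd) z + (w \<bullet> nrm H y) / (?m \<bullet> nrm H y)\<bar> \<le>
        2 ^ p * M * D ^ p * h ^ p + 2 * M * (E * h ^ p) + 4 * (1 + 2 * M)\<^sup>2 * (N * h ^ p)"
      using 1 2 ratio[OF w] slope by linarith
    also have "\<dots> = (2 ^ p * M * D ^ p + 2 * M * E + 4 * (1 + 2 * M)\<^sup>2 * N) * h ^ p"
      by (simp add: algebra_simps)
    finally have "h * \<bar>poly2 p (taylor_coeff ?fd) z + (w \<bullet> nrm H y) / (?m \<bullet> nrm H y)\<bar> \<le>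
        h * ((2 ^ p * M * D ^ p + 2 * M * E + 4 * (1 + 2 * M)\<^sup>2 * N) * h ^ p)"
      using h by (intro mult_left_mono) auto
    also have "\<dots> = (2 ^ p * M * D ^ p + 2 * M * E + 4 * (1 + 2 * M)\<^sup>2 * N) * h ^ Suc p"
      by simp
    also note bounds(2)
    also have "h * \<bar>poly2 p (taylor_coeff ?fd) z + (w \<bullet> nrm H y) / (?m \<bullet> nrm H y)\<bar> =
        \<bar>h * poly2 p (taylor_coeff ?fd) z - - h * ((w \<bullet> nrm H y) / (?m \<bullet> nrm H y))\<bar>"
      by (rule abs_row)
    finally show ?thesis .
  qed

  show ?thesis
  proof (cases e)
    case Value
    have 1: "\<bar>f z - poly2 (Suc p) (taylor_coeff f) z\<bar> \<le> 2 ^ Suc p * M * D ^ Suc p * h ^ Suc p"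
      by (rule taylor[OF Ck bd])
    have 2: "\<bar>f z - f z'\<bar> \<le> 2 * M * (E * h ^ Suc p)"
      using Ck bd by (intro lip) (auto intro: Ck_on_mono derivs_bounded_mono)
    have fz': "f z' = ?m \<bullet> (y' - x)" using lh y'b by (simp add: local_height_def z'_def)
    have "\<bar>?m \<bullet> (y' - y)\<bar> \<le> E * h ^ Suc p"
      using Cauchy_Schwarz_ineq2[of ?m "y' - y"] frn(3) yy' by (simp add: dist_norm norm_minus_commute)
    moreover have "?m \<bullet> (y' - y) = f z' - ?m \<bullet> (y - x)"
      unfolding fz' by (simp add: inner_diff_right)
    ultimately have 3: "\<bar>f z' - ?m \<bullet> (y - x)\<bar> \<le> E * h ^ Suc p" by simp
    have "\<bar>poly2 (Suc p) (taylor_coeff f) z - ?m \<bullet> (y - x)\<bar> \<le>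
        2 ^ Suc p * M * D ^ Suc p * h ^ Suc p + 2 * M * (E * h ^ Suc p) + E * h ^ Suc p"
      using 1 2 3 by linarith
    also have "\<dots> = (2 ^ Suc p * M * D ^ Suc p + 2 * M * E + E) * h ^ Suc p"
      by (simp only: distrib_right mult.assoc)
    also note bounds(1)
    finally show ?thesis unfolding Value rows by simp
  next
    case DerivU
    have "poly2 p (\<lambda>j k. real (Suc j) * taylor_coeff f (Suc j) k) z = poly2 p (taylor_coeff (partial_u f)) z"
      using z(1) le_less_trans[OF norm_ge_zero[of z], of r]
      by (intro poly2_cong taylor_coeff_partial_u[OF open_ball _ Ck, symmetric]) auto
    moreover have "fit_rhs H x (y, DerivU) = - h * ((?s \<bullet> nrm H y) / (?m \<bullet> nrm H y))"
      by (simp add: h_def)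
    moreover have "partial_u f z' = - ((?s \<bullet> \<nu> y') / g)"
      using ab(1) g0 by (simp flip: fu_def a_def)
    ultimately show ?thesis
      using deriv_row[OF basis(1) frn(1)] abg1(1) unfolding DerivU rows a_def by metis
  next
    case DerivV
    have "poly2 p (\<lambda>j k. real (Suc k) * taylor_coeff f j (Suc k)) z = poly2 p (taylor_coeff (partial_v f)) z"
      by (intro poly2_cong taylor_coeff_partial_v[symmetric])
    moreover have "fit_rhs H x (y, DerivV) = - h * ((?t \<bullet> nrm H y) / (?m \<bullet> nrm H y))"
      by (simp add: h_def)
    moreover have "partial_v f z' = - ((?t \<bullet> \<nu> y') / g)"
      using ab(2) g0 by (simp flip: fv_def b_def)
    ultimately show ?thesis
      using deriv_row[OF basis(2) frn(2)] abg1(2) unfolding DerivV rows b_def by metis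
  qed
qed

section \<open>Error of the reconstruction\<close>

lemma ring_nbhd_subset: "ring_nbhd T n v \<subseteq> mesh_verts T"
  by (induction T n v rule: ring_nbhd.induct)
    (fastforce simp: one_half_ring_def one_ring_def mesh_verts_def)+

lemma ring_nbhd_refl: "v \<in> mesh_verts T \<Longrightarrow> v \<in> ring_nbhd T n v"
  by (induction T n v rule: ring_nbhd.induct)
    (auto simp: one_half_ring_def one_ring_def mesh_verts_def)

lemma finite_tri_verts [simp]: "finite (tri_verts f)"
  by (cases f) (simp add: tri_verts_def)

lemma compact_mesh_space: "finite T \<Longrightarrow> compact (mesh_space T)"
  unfolding mesh_space_def by (intro compact_UN finite_imp_compact_convex_hull) auto

lemma stencil_subset_mesh_verts: "stencil H x \<subseteq> mesh_verts (faces H)"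
  unfolding stencil_def vertex_stencil_def using ring_nbhd_subset by blast

lemma finite_stencil: "finite (faces H) \<Longrightarrow> finite (stencil H x)"
  by (rule finite_subset[OF stencil_subset_mesh_verts]) (simp add: mesh_verts_def)

lemma stencil_near:
  assumes ok: "hcmf_ok P p H" and x: "x \<in> mesh_space (faces H)"
  shows "stencil H x \<noteq> {}" "y \<in> stencil H x \<Longrightarrow> dist x y \<le> diameter (stencil H x)"
proof -
  have fin: "finite (faces H)" using ok by (simp add: hcmf_ok_def triangular_mesh_def)
  obtain f where "f \<in> faces H" "cell H x \<subseteq> tri_verts f" and hull: "x \<in> convex hull (cell H x)"
    using ok x unfolding hcmf_ok_def by blast
  then have "cell H x \<subseteq> mesh_verts (faces H)" unfolding mesh_verts_def by blast
  then have sub: "cell H x \<subseteq> stencil H x"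
    unfolding stencil_def vertex_stencil_def using ring_nbhd_refl by blast
  show "stencil H x \<noteq> {}" using sub hull by (metis convex_hull_empty empty_iff subset_empty)
  assume y: "y \<in> stencil H x"
  have "cell H x \<subseteq> cball y (diameter (stencil H x))"
    using sub y finite_imp_bounded[OF finite_stencil[OF fin]] diameter_bounded_bound by fastforce
  then have "convex hull (cell H x) \<subseteq> cball y (diameter (stencil H x))"
    by (intro hull_minimal) auto
  then show "dist x y \<le> diameter (stencil H x)" using hull by (auto simp: dist_commute)
qed

lemma cond_number_le_nonneg:
  "\<lbrakk>cond_number_le R C A K; finite R; finite C\<rbrakk> \<Longrightarrow> 0 \<le> K"
  unfolding cond_number_le_def
  by (meson mat_norm_nonneg mult_nonneg_nonneg order_trans)

lemma fit_error:
  assumes full: "full_column_rank (fit_rows H x) (fit_cols p) (weighted_vandermonde P p H x)"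
    and cond: "cond_number_le (fit_rows H x) (fit_cols p) (weighted_vandermonde P p H x) K"
    and X: "fit_solution P p H x X"
    and st: "finite (stencil H x)" "stencil H x \<noteq> {}" "card (stencil H x) \<le> m"
    and res: "\<And>y e. y \<in> stencil H x \<Longrightarrow>
      \<bar>mat_vec (fit_cols p) (vandermonde H x) Y (y, e) - fit_rhs H x (y, e)\<bar> \<le> \<epsilon>"
  shows "\<bar>X (0, 0) - Y (0, 0)\<bar> \<le> 6 * K * real m * \<epsilon>"
proof -
  let ?R = "fit_rows H x" and ?C = "fit_cols p" and ?A = "weighted_vandermonde P p H x"
  let ?w = "\<lambda>r. hcmf_weight P p H x (fst r)"
  let ?b = "\<lambda>r. ?w r * fit_rhs H x r"
  have fin: "finite ?R" "finite ?C" using st by (simp_all add: fit_rows_def fit_cols_altdef)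
  let ?W = "(\<lambda>y. \<bar>hcmf_weight P p H x y\<bar>) ` stencil H x"
  have W: "finite ?W" "?W \<noteq> {}" using st by auto
  obtain y0 where y0: "y0 \<in> stencil H x" "Max ?W = \<bar>hcmf_weight P p H x y0\<bar>"
    using Max_in[OF W] by blast
  have y0_max: "\<bar>hcmf_weight P p H x y\<bar> \<le> \<bar>hcmf_weight P p H x y0\<bar>" if "y \<in> stencil H x" for y
    using Max_ge[OF W(1)] that unfolding y0(2) by blast
  have \<epsilon>: "0 \<le> \<epsilon>" using res[OF y0(1), of Value] by linarith
  have mv: "mat_vec ?C ?A Z r - ?b r = ?w r * (mat_vec ?C (vandermonde H x) Z r - fit_rhs H x r)" for Z r
    by (simp add: mat_vec_def weighted_vandermonde_def sum_distrib_left right_diff_distrib mult_ac)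
  have "\<bar>X (0, 0) - Y (0, 0)\<bar> \<le> 2 * K * real (card ?R) * \<epsilon>"
  proof (rule least_squares_perturbation[OF fin full cond, where b = ?b and ?r0.0 = "(y0, Value)" and ?c0.0 = "(0, 0)"])
    show "L2_set (\<lambda>r. mat_vec ?C ?A X r - ?b r) ?R \<le> L2_set (\<lambda>r. mat_vec ?C ?A Y r - ?b r) ?R"
      using X unfolding fit_solution_def is_arg_min_def mv by (meson not_less)
    fix r assume r: "r \<in> ?R"
    obtain y e where ye: "r = (y, e)" "y \<in> stencil H x" using r by (auto simp: fit_rows_def)
    have "\<bar>?w r\<bar> * \<bar>mat_vec ?C (vandermonde H x) Y r - fit_rhs H x r\<bar> \<le> \<bar>hcmf_weight P p H x y0\<bar> * \<epsilon>"
      using y0_max[OF ye(2)] res[OF ye(2)] unfolding ye(1) by (intro mult_mono) auto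
    then show "\<bar>mat_vec ?C ?A Y r - ?b r\<bar> \<le> \<bar>?A (y0, Value) (0, 0)\<bar> * \<epsilon>"
      unfolding mv by (simp add: abs_mult weighted_vandermonde_def)
  qed (use y0 \<epsilon> in \<open>auto simp: fit_rows_def fit_cols_def\<close>)
  also have "card ?R = 3 * card (stencil H x)"
    by (simp add: fit_rows_def card_cartesian_product)
  also have "2 * K * real (3 * card (stencil H x)) * \<epsilon> \<le> 2 * K * real (3 * m) * \<epsilon>"
    using st(3) \<epsilon> cond_number_le_nonneg[OF cond fin] by (intro mult_right_mono mult_left_mono) auto
  finally show ?thesis by simp
qed

theorem proposition2:
  fixes p :: nat
    and \<Gamma> :: "(real^3) set" and \<nu> :: "real^3 \<Rightarrow> real^3"
    and P :: hcmf_consts and H :: "'i \<Rightarrow> hcmf" and F :: "'i filter"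
  assumes "1 \<le> p"
    and "smooth_surface \<Gamma>"
    and "unit_normal_field \<Gamma> \<nu>"
    and "hcmf_consts_ok P"
    and "\<forall>\<^sub>F i in F. hcmf_ok P p (H i)"
    and "filterlim (\<lambda>i. hsize (H i)) (at_right 0) F"
    and "\<forall>\<^sub>F i in F. mesh_space (faces (H i)) homeomorphic \<Gamma>"
    and "relatively_uniform F H"
    and "heights_bounded (p + 1) \<Gamma> F H"
    and "vertices_accurate (p + 1) \<Gamma> F H"
    and "normals_accurate p \<Gamma> \<nu> F H nrm"
    and "normals_accurate 1 \<Gamma> \<nu> F H anrm"
    and "well_conditioned P p F H"
  shows "\<exists>C. \<forall>\<^sub>F i in F. \<forall>q\<in>hcmf_surface P p (H i).
           dist q (closest_point \<Gamma> q) \<le> C * hsize (H i) ^ (p + 1)"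
proof -
  obtain m D where stencils: "\<forall>\<^sub>F i in F. \<forall>x\<in>mesh_space (faces (H i)).
      card (stencil (H i) x) \<le> m \<and> diameter (stencil (H i) x) \<le> D * hsize (H i)"
    using assms(8) unfolding relatively_uniform_def by blast
  obtain r M where "0 < r" and heights: "\<forall>\<^sub>F i in F. \<forall>x\<in>mesh_space (faces (H i)). \<exists>f.
      local_height \<Gamma> (H i) x r f \<and> Ck_on (p + 1) (ball 0 r) f \<and> derivs_bounded (p + 1) M (ball 0 r) f"
    using assms(9) unfolding heights_bounded_def by blast
  obtain E where verts: "\<forall>\<^sub>F i in F. \<forall>v\<in>mesh_verts (faces (H i)).
      dist v (closest_point \<Gamma> v) \<le> E * hsize (H i) ^ (p + 1)"
    using assms(10) unfolding vertices_accurate_def by blast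
  obtain N where normals: "\<forall>\<^sub>F i in F. \<forall>v\<in>mesh_verts (faces (H i)).
      norm (nrm (H i) v - \<nu> (closest_point \<Gamma> v)) \<le> N * hsize (H i) ^ p"
    using assms(11) unfolding normals_accurate_def by blast
  obtain K where wellcond: "\<forall>\<^sub>F i in F. \<forall>x\<in>mesh_space (faces (H i)).
      full_column_rank (fit_rows (H i) x) (fit_cols p) (weighted_vandermonde P p (H i) x) \<and>
      cond_number_le (fit_rows (H i) x) (fit_cols p) (weighted_vandermonde P p (H i) x) K"
    using assms(13) unfolding well_conditioned_def by blast
  have h0: "((\<lambda>i. hsize (H i)) \<longlongrightarrow> 0) F" and hpos: "\<forall>\<^sub>F i in F. 0 < hsize (H i)"
    using assms(6) by (auto simp: filterlim_at greaterThan_iff elim: eventually_mono)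
  have small: "\<forall>\<^sub>F i in F. c * hsize (H i) < b" if "0 < b" for c b :: real
    using order_tendstoD(2)[OF tendsto_mult_right_zero[OF h0] that] .
  define B where "B = 2 ^ Suc p * M * D ^ Suc p + 2 ^ p * M * D ^ p + 4 * M * E + E + 4 * (1 + 2 * M)\<^sup>2 * N"
  have "\<forall>\<^sub>F i in F. \<forall>q\<in>hcmf_surface P p (H i).
      dist q (closest_point \<Gamma> q) \<le> (6 * K * real m * B) * hsize (H i) ^ (p + 1)"
    using assms(5,7) stencils heights verts normals wellcond hpos small[of 1 1, OF zero_less_one]
      small[OF \<open>0 < r\<close>, of "D + E"] small[of 1 "2 * (1 + 2 * M) * N", OF zero_less_one]
  proof eventually_elim
    case (elim i)
    let ?H = "H i" and ?h = "hsize (H i)"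
    show ?case
    proof
      fix q assume "q \<in> hcmf_surface P p ?H"
      then obtain x X where q: "q = x + fit_coeff ?H X 0 0 *\<^sub>R mvec ?H x"
        and x: "x \<in> mesh_space (faces ?H)" and X: "fit_solution P p ?H x X"
        unfolding hcmf_surface_def by blast
      have fin: "finite (faces ?H)" using elim(1) by (simp add: hcmf_ok_def triangular_mesh_def)
      have closed: "closed \<Gamma>"
        using compact_mesh_space[OF fin] homeomorphic_compactness[OF elim(2)] compact_imp_closed by blast
      have "\<Gamma> \<noteq> {}" using elim(2) x by (auto simp: homeomorphic_empty)
      then have cp: "closest_point \<Gamma> y \<in> \<Gamma>" for y
        using closest_point_in_set[OF closed] by blast
      obtain f where f: "local_height \<Gamma> ?H x r f" "Ck_on (Suc p) (ball 0 r) f"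
          "derivs_bounded (Suc p) M (ball 0 r) f"
        using elim(4) x by auto
      have fr: "orthonormal_frame (svec ?H x) (tvec ?H x) (mvec ?H x)"
        using elim(1) x unfolding hcmf_ok_def orthonormal_frame_def by blast
      let ?Y = "taylor_solution ?h f"
      have "\<bar>X (0, 0) - ?Y (0, 0)\<bar> \<le> 6 * K * real m * (B * ?h ^ Suc p)"
      proof (rule fit_error[OF _ _ X finite_stencil[OF fin] stencil_near(1)[OF elim(1) x]])
        fix y e assume y: "y \<in> stencil ?H x"
        then have v: "y \<in> mesh_verts (faces ?H)" using stencil_subset_mesh_verts by blast
        show "\<bar>mat_vec (fit_cols p) (vandermonde ?H x) ?Y (y, e) - fit_rhs ?H x (y, e)\<bar> \<le> B * ?h ^ Suc p"
          unfolding B_def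
        proof (rule fit_consistency[OF fr f(1) assms(3) f(2,3) assms(1) elim(8) _ cp])
          show "dist y (closest_point \<Gamma> y) \<le> E * ?h ^ Suc p" using elim(5) v by simp
          show "dist x y \<le> D * ?h"
            using stencil_near(2)[OF elim(1) x y] elim(3) x by force
          show "norm (nrm ?H y - \<nu> (closest_point \<Gamma> y)) \<le> N * ?h ^ p" using elim(6) v by simp
        qed (use elim(9-11) in auto)
      qed (use elim(3,7) x in auto)
      then have "\<bar>X (0, 0) - f 0\<bar> \<le> 6 * K * real m * B * ?h ^ (p + 1)"
        by (simp add: taylor_solution_def taylor_coeff_def mult_ac)
      moreover have "x + f 0 *\<^sub>R mvec ?H x \<in> \<Gamma>"
        using f(1) \<open>0 < r\<close> unfolding local_height_def by (auto dest: bspec[of _ _ 0])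
      then have "dist q (closest_point \<Gamma> q) \<le> dist q (x + f 0 *\<^sub>R mvec ?H x)"
        by (rule closest_point_le[OF closed])
      moreover have "dist q (x + f 0 *\<^sub>R mvec ?H x) = \<bar>X (0, 0) - f 0\<bar>"
        using fr by (simp add: q fit_coeff_def dist_norm orthonormal_frame_def flip: scaleR_left_diff_distrib)
      ultimately show "dist q (closest_point \<Gamma> q) \<le> (6 * K * real m * B) * ?h ^ (p + 1)"
        by simp
    qed
  qed
  then show ?thesis by blast
qed

end
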